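(* Let $n \ge 2$ and $r \ge 1$ be integers, let $C$ be a complex Hermitian $n \times n$ matrix, and let $z \in \mathbf{C}^n$ with $|z_i| = 1$ for all $i = 1, \dots, n$. Suppose that $L(z) := \operatorname{Re}(\operatorname{ddiag}(C z z^* )) - C$ satisfies $L(z) z = 0$ and $L(z) \succeq 0$ with $\lambda_2(L(z)) > 0$. Let $D$ be any (strictly) positive definite diagonal $n\times n$ matrix, and set $L_D(z) := D^{-1/2} L(z) D^{-1/2}$. If $$ 2 r > \frac{\lambda_n(L_D(z))}{\lambda_2(L_D(z))}, $$ then every second-order critical point $Y$ of the optimization problem $$ \max_{Y \in \mathbf{C}^{n \times r}} \ \langle C, Y Y^* \rangle \quad \text{subject to} \quad \operatorname{diag}(Y Y^* ) = \mathbf{1} $$ is a global optimum of this problem and satisfies $Y Y^* = z z^*$.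
   Context: Notation: $\langle A, B\rangle = \operatorname{Re}(\operatorname{tr}(A^* B))$ (a real inner product); $\mathbf{1}$ is the all-ones vector in $\mathbf{R}^n$; for a square matrix $A$, $\operatorname{diag}(A)$ is the vector of its diagonal entries and $\operatorname{ddiag}(A)$ is the diagonal matrix with the same diagonal as $A$; $\operatorname{Re}$ is applied entrywise. The (real) eigenvalues of a Hermitian $n\times n$ matrix $A$ are denoted in increasing order $\lambda_1(A) \le \cdots \le \lambda_n(A)$. Second-order critical point: criticality is understood with respect to the real and imaginary parts of $Y$ as real variables, on the real manifold of feasible points (product of unit spheres of $\mathbf{C}^r$): the Riemannian gradient is zero and the Riemannian Hessian is negative semidefinite. Equivalently, $Y$ is feasible and, with $S(Y) := \operatorname{Re}(\operatorname{ddiag}(C Y Y^* )) - C$, one has $S(Y) Y = 0$ and $\langle S(Y), \dot Y \dot Y^*\rangle \ge 0$ for all $\dot Y \in \mathbf{C}^{n \times r}$ with $\operatorname{Re}(\operatorname{diag}(Y \dot Y^* )) = 0$. *)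

theory Defs
  imports
    "HOL-Analysis.Analysis"
    "HOL-Computational_Algebra.Polynomial"
begin

unbundle no fps_syntax

section \<open>Complex matrices\<close>

definition ctranspose :: "complex^'n^'m \<Rightarrow> complex^'m^'n" where
  "ctranspose A = (\<chi> i j. cnj (A $ j $ i))"

definition hermitian :: "complex^'n^'n \<Rightarrow> bool" where
  "hermitian A \<longleftrightarrow> ctranspose A = A"

definition mat_inner :: "complex^'n^'m \<Rightarrow> complex^'n^'m \<Rightarrow> real" where
  "mat_inner A B = Re (trace (ctranspose A ** B))"

definition quad_form :: "complex^'n^'n \<Rightarrow> complex^'n \<Rightarrow> complex" where
  "quad_form A x = (\<Sum>i\<in>UNIV. cnj (x $ i) * (A *v x) $ i)"

text \<open>For Hermitian \<open>A\<close> the value \<open>quad_form A x\<close> is real, so that the real part is harmless.\<close>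

definition pos_semidef :: "complex^'n^'n \<Rightarrow> bool" where
  "pos_semidef A \<longleftrightarrow> hermitian A \<and> (\<forall>x. 0 \<le> Re (quad_form A x))"

definition pos_def :: "complex^'n^'n \<Rightarrow> bool" where
  "pos_def A \<longleftrightarrow> hermitian A \<and> (\<forall>x. x \<noteq> 0 \<longrightarrow> 0 < Re (quad_form A x))"

definition diag_vec :: "'a^'n^'n \<Rightarrow> 'a^'n" where
  "diag_vec A = (\<chi> i. A $ i $ i)"

definition ddiag :: "'a::zero^'n^'n \<Rightarrow> 'a^'n^'n" where
  "ddiag A = (\<chi> i j. if i = j then A $ i $ i else 0)"

definition diagonal :: "'a::zero^'n^'n \<Rightarrow> bool" where
  "diagonal A \<longleftrightarrow> (\<forall>i j. i \<noteq> j \<longrightarrow> A $ i $ j = 0)"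

definition re_mat :: "complex^'n^'m \<Rightarrow> complex^'n^'m" where
  "re_mat A = (\<chi> i j. complex_of_real (Re (A $ i $ j)))"

definition outer :: "complex^'n \<Rightarrow> complex^'n^'n" where
  "outer z = (\<chi> i j. z $ i * cnj (z $ j))"

text \<open>\<open>D\<^sup>-\<^sup>1\<^sup>/\<^sup>2\<close>; meaningful only for a positive definite diagonal matrix \<open>D\<close>
  (whose diagonal entries are positive reals).\<close>

definition diag_inv_sqrt :: "complex^'n^'n \<Rightarrow> complex^'n^'n" where
  "diag_inv_sqrt D =
     (\<chi> i j. if i = j then complex_of_real (1 / sqrt (Re (D $ i $ i))) else 0)"


section \<open>Ordered eigenvalues\<close>

definition char_poly :: "complex^'n^'n \<Rightarrow> complex poly" where
  "char_poly A = det (\<chi> i j. (if i = j then [:0, 1:] else 0) - [:A $ i $ j:])"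

text \<open>The eigenvalues with algebraic multiplicity, in increasing order.
  Only used for Hermitian matrices, whose eigenvalues are real.\<close>

definition eigval_list :: "complex^'n^'n \<Rightarrow> real list" where
  "eigval_list A = sorted_list_of_multiset (image_mset Re (proots (char_poly A)))"

text \<open>Counting starts at 1: \<open>eigval 1 A \<le> \<dots> \<le> eigval CARD('n) A\<close>.\<close>

definition eigval :: "nat \<Rightarrow> complex^'n^'n \<Rightarrow> real" where
  "eigval k A = eigval_list A ! (k - 1)"


section \<open>The optimization problem\<close>

definition feasible :: "complex^'r^'n \<Rightarrow> bool" where
  "feasible Y \<longleftrightarrow> diag_vec (Y ** ctranspose Y) = 1"

definition objective :: "complex^'n^'n \<Rightarrow> complex^'r^'n \<Rightarrow> real" where
  "objective C Y = mat_inner C (Y ** ctranspose Y)"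

definition global_optimum :: "complex^'n^'n \<Rightarrow> complex^'r^'n \<Rightarrow> bool" where
  "global_optimum C Y \<longleftrightarrow>
     feasible Y \<and> (\<forall>Y'::complex^'r^'n. feasible Y' \<longrightarrow> objective C Y' \<le> objective C Y)"

text \<open>With \<open>X = Y Y\<^sup>*\<close> this is \<open>S(Y)\<close>, with \<open>X = z z\<^sup>*\<close> it is \<open>L(z)\<close>.\<close>

definition certificate :: "complex^'n^'n \<Rightarrow> complex^'n^'n \<Rightarrow> complex^'n^'n" where
  "certificate C X = re_mat (ddiag (C ** X)) - C"


section \<open>Second-order critical points\<close>

text \<open>The feasible set is an embedded real submanifold of \<open>complex^'r^'n\<close>, viewed as a
  Euclidean space; its library inner product is \<open>mat_inner\<close> (see \<open>mat_inner_eq_inner\<close>). The tangent space is the kernel of the differential of the constraint.\<close>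

definition tangent_space :: "complex^'r^'n \<Rightarrow> (complex^'r^'n) set" where
  "tangent_space Y = {V. \<forall>i. Re (diag_vec (Y ** ctranspose V) $ i) = 0}"

text \<open>For feasible \<open>Y\<close> this is the orthogonal projection onto the tangent space at \<open>Y\<close>
  (see \<open>tangent_proj_in_tangent_space\<close> and \<open>tangent_proj_orthogonal\<close>). The formula makes
  sense for all \<open>Y\<close>, which provides the smooth extension of the Riemannian gradient to the
  ambient space that is differentiated in the Hessian.\<close>

definition tangent_proj :: "complex^'r^'n \<Rightarrow> complex^'r^'n \<Rightarrow> complex^'r^'n" where
  "tangent_proj Y Z = Z - re_mat (ddiag (Z ** ctranspose Y)) ** Y"

definition euclidean_gradient :: "('a::euclidean_space \<Rightarrow> real) \<Rightarrow> 'a \<Rightarrow> 'a" where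
  "euclidean_gradient f x = (THE g. GDERIV f x :> g)"

definition riemannian_gradient ::
    "(complex^'r^'n \<Rightarrow> real) \<Rightarrow> complex^'r^'n \<Rightarrow> complex^'r^'n" where
  "riemannian_gradient f Y = tangent_proj Y (euclidean_gradient f Y)"

definition riemannian_hessian ::
    "(complex^'r^'n \<Rightarrow> real) \<Rightarrow> complex^'r^'n \<Rightarrow> complex^'r^'n \<Rightarrow> complex^'r^'n" where
  "riemannian_hessian f Y V =
     tangent_proj Y (frechet_derivative (riemannian_gradient f) (at Y) V)"

text \<open>For maximization: the Hessian has to be negative semidefinite.\<close>

definition second_order_critical :: "(complex^'r^'n \<Rightarrow> real) \<Rightarrow> complex^'r^'n \<Rightarrow> bool" where
  "second_order_critical f Y \<longleftrightarrow>
     feasible Y \<and> riemannian_gradient f Y = 0 \<and>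
     (\<forall>V\<in>tangent_space Y. mat_inner V (riemannian_hessian f Y V) \<le> 0)"


section \<open>Explicit form of the criticality conditions\<close>

lemma mat_inner_eq_inner: "mat_inner A B = inner A B"
proof -
  have "mat_inner A B = (\<Sum>j\<in>UNIV. \<Sum>i\<in>UNIV. inner (A $ i $ j) (B $ i $ j))"
    by (simp add: mat_inner_def trace_def ctranspose_def matrix_matrix_mult_def inner_complex_def)
  also have "\<dots> = inner A B"
    unfolding inner_vec_def by (rule sum.swap)
  finally show ?thesis .
qed

lemma diag_mult_ctranspose: "Re ((A ** ctranspose B) $ i $ i) = inner (A $ i) (B $ i)"
  by (simp add: ctranspose_def matrix_matrix_mult_def inner_vec_def inner_complex_def)

lemma feasible_iff: "feasible Y \<longleftrightarrow> (\<forall>i. norm (Y $ i) = 1)"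
proof -
  have "(Y ** ctranspose Y) $ i $ i = complex_of_real (inner (Y $ i) (Y $ i))" for i
    unfolding complex_eq_iff diag_mult_ctranspose[symmetric]
    by (simp add: ctranspose_def matrix_matrix_mult_def)
  then have "feasible Y \<longleftrightarrow> (\<forall>i. inner (Y $ i) (Y $ i) = 1)"
    by (simp add: feasible_def diag_vec_def vec_eq_iff)
  then show ?thesis
    by (simp add: norm_eq_1)
qed

lemma tangent_space_iff: "V \<in> tangent_space Y \<longleftrightarrow> (\<forall>i. inner (Y $ i) (V $ i) = 0)"
  by (simp add: tangent_space_def diag_vec_def diag_mult_ctranspose)

lemma re_ddiag_mult_row:
  "(re_mat (ddiag A) ** Y) $ i = Re (A $ i $ i) *\<^sub>R Y $ i"
proof -
  have "(re_mat (ddiag A) ** Y) $ i $ k = (Re (A $ i $ i) *\<^sub>R Y $ i) $ k" for k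
  proof -
    have "(re_mat (ddiag A) ** Y) $ i $ k =
        (\<Sum>j\<in>UNIV. if i = j then complex_of_real (Re (A $ i $ i)) * Y $ j $ k else 0)"
      unfolding matrix_matrix_mult_def re_mat_def ddiag_def vec_lambda_beta
      by (rule sum.cong) simp_all
    also have "\<dots> = complex_of_real (Re (A $ i $ i)) * Y $ i $ k"
      by simp
    finally show ?thesis
      by (simp only: vector_scaleR_component scaleR_conv_of_real[where 'a = complex])
  qed
  then show ?thesis by (simp add: vec_eq_iff)
qed

lemma tangent_proj_row:
  "tangent_proj Y Z $ i = Z $ i - inner (Z $ i) (Y $ i) *\<^sub>R Y $ i"
  by (simp add: tangent_proj_def re_ddiag_mult_row diag_mult_ctranspose)

lemma tangent_proj_in_tangent_space:
  assumes "feasible Y"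
  shows "tangent_proj Y Z \<in> tangent_space Y"
  using assms
  by (simp add: tangent_space_iff tangent_proj_row inner_diff_right feasible_iff norm_eq_1
      inner_commute)

lemma inner_rows: "inner V W = (\<Sum>i\<in>UNIV. inner (V $ i) (W $ i))"
  for V W :: "complex^'r^'n"
  by (rule inner_vec_def)

lemma tangent_inner_re_ddiag_mult:
  assumes "V \<in> tangent_space Y"
  shows "inner V (re_mat (ddiag A) ** Y) = 0"
  using assms unfolding inner_rows[of V]
  by (simp add: re_ddiag_mult_row tangent_space_iff inner_commute)

lemma tangent_proj_orthogonal:
  assumes "V \<in> tangent_space Y"
  shows "inner V (Z - tangent_proj Y Z) = 0"
  using tangent_inner_re_ddiag_mult[OF assms] by (simp add: tangent_proj_def)

lemma ctranspose_mult: "ctranspose (A ** B) = ctranspose B ** ctranspose A"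
  by (simp add: ctranspose_def matrix_matrix_mult_def vec_eq_iff mult.commute)

lemma ctranspose_ctranspose [simp]: "ctranspose (ctranspose A) = A"
  by (simp add: ctranspose_def vec_eq_iff)

lemma trace_mult_commute:
  "trace (A ** B) = trace (B ** A)" for A :: "complex^'n^'m" and B :: "complex^'m^'n"
proof -
  have "trace (A ** B) = (\<Sum>i\<in>UNIV. \<Sum>k\<in>UNIV. A $ i $ k * B $ k $ i)"
    by (simp add: trace_def matrix_matrix_mult_def)
  also have "\<dots> = (\<Sum>k\<in>UNIV. \<Sum>i\<in>UNIV. A $ i $ k * B $ k $ i)"
    by (rule sum.swap)
  also have "\<dots> = trace (B ** A)"
    by (simp add: trace_def matrix_matrix_mult_def mult.commute)
  finally show ?thesis .
qed

lemma mat_inner_mult_ctranspose: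
  assumes "hermitian A"
  shows "mat_inner A (Y ** ctranspose Z) = inner Z (A ** Y)"
proof -
  have "mat_inner A (Y ** ctranspose Z) = Re (trace ((A ** Y) ** ctranspose Z))"
    using assms by (simp only: mat_inner_def hermitian_def matrix_mul_assoc)
  also have "\<dots> = Re (trace (ctranspose Z ** (A ** Y)))"
    by (simp only: trace_mult_commute[of "A ** Y"])
  also have "\<dots> = inner Z (A ** Y)"
    by (simp only: mat_inner_def flip: mat_inner_eq_inner)
  finally show ?thesis .
qed

lemma inner_mult_hermitian:
  assumes "hermitian A"
  shows "inner (A ** Y) Z = inner Y (A ** Z)"
proof -
  have "inner (A ** Y) Z = Re (trace ((ctranspose Y ** ctranspose A) ** Z))"
    by (simp only: mat_inner_def ctranspose_mult flip: mat_inner_eq_inner)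
  also have "\<dots> = Re (trace (ctranspose Y ** (A ** Z)))"
    using assms by (simp only: hermitian_def matrix_mul_assoc)
  also have "\<dots> = inner Y (A ** Z)"
    by (simp only: mat_inner_def flip: mat_inner_eq_inner)
  finally show ?thesis .
qed

lemma linear_mult_left: "linear (\<lambda>Y. A ** Y)" for A :: "complex^'n^'m"
  by (rule linearI)
    (simp_all add: matrix_matrix_mult_def vec_eq_iff scaleR_sum_right distrib_left sum.distrib)

lemma has_derivative_mult_left [derivative_intros]:
  fixes f :: "'a::real_normed_vector \<Rightarrow> complex^'k^'n"
  assumes "(f has_derivative f') F"
  shows "((\<lambda>x. A ** f x) has_derivative (\<lambda>h. A ** f' h)) F"
proof -
  have "bounded_linear (\<lambda>Y :: complex^'k^'n. A ** Y)"
    using linear_mult_left by (simp only: linear_conv_bounded_linear)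
  from bounded_linear.has_derivative[OF this assms] show ?thesis .
qed

lemma euclidean_gradient_objective:
  assumes "hermitian C"
  shows "euclidean_gradient (objective C) Y = 2 *\<^sub>R (C ** Y)"
proof -
  have *: "objective C = (\<lambda>Y. inner (C ** Y) Y)"
    using assms by (simp add: fun_eq_iff objective_def mat_inner_mult_ctranspose inner_commute)
  have "((\<lambda>Y. inner (C ** Y) Y) has_derivative (\<lambda>h. inner (C ** Y) h + inner (C ** h) Y)) (at Y)"
    by (auto intro!: derivative_eq_intros)
  moreover have "inner (C ** Y) h + inner (C ** h) Y = inner h (2 *\<^sub>R (C ** Y))" for h
    using inner_mult_hermitian[OF assms, of h Y] by (simp add: inner_commute)
  ultimately have g: "GDERIV (objective C) Y :> 2 *\<^sub>R (C ** Y)"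
    by (simp add: gderiv_def *)
  moreover have "g = 2 *\<^sub>R (C ** Y)" if "GDERIV (objective C) Y :> g" for g
  proof -
    have "(\<lambda>h. inner h g) = (\<lambda>h. inner h (2 *\<^sub>R (C ** Y)))"
      using that g unfolding gderiv_def by (rule has_derivative_unique)
    then have "inner h g = inner h (2 *\<^sub>R (C ** Y))" for h
      by (rule fun_cong)
    then show ?thesis
      by (rule vector_eq_ldot[THEN iffD1, OF allI])
  qed
  ultimately show ?thesis
    unfolding euclidean_gradient_def by (rule the_equality)
qed

lemma matrix_mult_diff_left: "(A - B) ** V = A ** V - B ** V"
  for A B :: "complex^'n^'m" and V :: "complex^'k^'n"
  by (simp add: matrix_matrix_mult_def vec_eq_iff left_diff_distrib sum_subtractf)

lemma certificate_mult_row: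
  "(certificate C (Y ** ctranspose Y) ** V) $ i =
    inner ((C ** Y) $ i) (Y $ i) *\<^sub>R V $ i - (C ** V) $ i"
  by (simp add: certificate_def matrix_mult_diff_left re_ddiag_mult_row matrix_mul_assoc
      diag_mult_ctranspose)

lemma riemannian_gradient_objective:
  assumes "hermitian C"
  shows "riemannian_gradient (objective C) Y = - 2 *\<^sub>R (certificate C (Y ** ctranspose Y) ** Y)"
proof -
  have "riemannian_gradient (objective C) Y $ i =
      (- 2 *\<^sub>R (certificate C (Y ** ctranspose Y) ** Y)) $ i" for i
    by (simp add: riemannian_gradient_def euclidean_gradient_objective[OF assms]
        tangent_proj_row certificate_mult_row scaleR_diff_right)
  then show ?thesis
    by (subst vec_eq_iff) blast
qed

lemma hermitian_certificate: "hermitian C \<Longrightarrow> hermitian (certificate C X)"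
  by (auto simp: hermitian_def certificate_def ctranspose_def re_mat_def ddiag_def vec_eq_iff)

lemma has_derivative_vec_lambda:
  fixes f :: "'a::real_normed_vector \<Rightarrow> 'i::finite \<Rightarrow> 'b::euclidean_space"
  assumes "\<And>i. ((\<lambda>x. f x i) has_derivative (\<lambda>h. f' h i)) (at a)"
  shows "((\<lambda>x. \<chi> i. f x i) has_derivative (\<lambda>h. \<chi> i. f' h i)) (at a)"
proof (subst has_derivative_componentwise_within, rule ballI)
  fix e :: "'b^'i" assume "e \<in> Basis"
  then obtain k b where e: "e = axis k b" by (auto simp: Basis_vec_def)
  show "((\<lambda>x. inner (\<chi> i. f x i) e) has_derivative (\<lambda>h. inner (\<chi> i. f' h i) e)) (at a)"
    unfolding e inner_axis using has_derivative_inner_left[OF assms[of k], of b] by simp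
qed

lemma riemannian_hessian_objective:
  assumes C: "hermitian C" and V: "V \<in> tangent_space Y"
  shows "mat_inner V (riemannian_hessian (objective C) Y V) =
    - 2 * mat_inner (certificate C (Y ** ctranspose Y)) (V ** ctranspose V)"
proof -
  define S where "S = certificate C (Y ** ctranspose Y)"
  define G' where "G' = (\<lambda>h. \<chi> i. - 2 *\<^sub>R
    ((inner ((C ** h) $ i) (Y $ i) + inner ((C ** Y) $ i) (h $ i)) *\<^sub>R Y $ i
      + inner ((C ** Y) $ i) (Y $ i) *\<^sub>R h $ i - (C ** h) $ i))"
  have eq: "riemannian_gradient (objective C) =
      (\<lambda>Y. \<chi> i. - 2 *\<^sub>R (inner ((C ** Y) $ i) (Y $ i) *\<^sub>R Y $ i - (C ** Y) $ i))"
    by (subst fun_eq_iff, subst vec_eq_iff)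
      (simp add: riemannian_gradient_objective[OF C] certificate_mult_row)
  have "(riemannian_gradient (objective C) has_derivative G') (at Y)"
    unfolding eq G'_def
  proof (rule has_derivative_vec_lambda)
    fix i
    have a: "((\<lambda>Y. (C ** Y) $ i) has_derivative (\<lambda>h. (C ** h) $ i)) (at Y)"
      by (intro bounded_linear.has_derivative[OF bounded_linear_vec_nth]
          has_derivative_mult_left has_derivative_ident)
    have b: "((\<lambda>Y. Y $ i) has_derivative (\<lambda>h. h $ i)) (at Y)"
      by (intro bounded_linear.has_derivative[OF bounded_linear_vec_nth] has_derivative_ident)
    show "((\<lambda>Y. - 2 *\<^sub>R (inner ((C ** Y) $ i) (Y $ i) *\<^sub>R Y $ i - (C ** Y) $ i))
        has_derivative (\<lambda>h. - 2 *\<^sub>R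
          ((inner ((C ** h) $ i) (Y $ i) + inner ((C ** Y) $ i) (h $ i)) *\<^sub>R Y $ i
            + inner ((C ** Y) $ i) (Y $ i) *\<^sub>R h $ i - (C ** h) $ i))) (at Y)"
      by (rule has_derivative_eq_rhs[OF has_derivative_scaleR_right[OF has_derivative_diff[OF
            has_derivative_scaleR[OF has_derivative_inner[OF a b] b] a]]])
        (simp add: fun_eq_iff add.commute)
  qed
  then have "frechet_derivative (riemannian_gradient (objective C)) (at Y) = G'"
    by (rule frechet_derivative_at[symmetric])
  then have "mat_inner V (riemannian_hessian (objective C) Y V) = inner V (G' V)"
    using tangent_proj_orthogonal[OF V, of "G' V"]
    by (simp add: mat_inner_eq_inner riemannian_hessian_def inner_diff_right)
  also have "\<dots> = (\<Sum>i\<in>UNIV. - 2 * inner (V $ i) ((S ** V) $ i))"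
    unfolding inner_rows[of V]
  proof (rule sum.cong)
    fix i
    have "inner (V $ i) (Y $ i) = 0"
      using V by (simp add: tangent_space_iff inner_commute)
    then show "inner (V $ i) (G' V $ i) = - 2 * inner (V $ i) ((S ** V) $ i)"
      by (simp add: G'_def S_def certificate_mult_row inner_diff_right inner_add_right)
  qed simp
  also have "\<dots> = - 2 * inner V (S ** V)"
    by (simp only: inner_rows[of V] sum_distrib_left)
  also have "inner V (S ** V) = mat_inner S (V ** ctranspose V)"
    using hermitian_certificate[OF C] by (simp add: S_def mat_inner_mult_ctranspose)
  finally show ?thesis
    by (simp only: S_def)
qed

text \<open>The description of second-order critical points by first- and second-order conditions
  on \<open>S(Y)\<close>.\<close>

theorem second_order_critical_objective_iff:
  assumes "hermitian C"
  shows "second_order_critical (objective C) Y \<longleftrightarrow>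
    feasible Y \<and> certificate C (Y ** ctranspose Y) ** Y = 0 \<and>
    (\<forall>V\<in>tangent_space Y. 0 \<le> mat_inner (certificate C (Y ** ctranspose Y)) (V ** ctranspose V))"
  using assms
  by (auto simp: second_order_critical_def riemannian_gradient_objective riemannian_hessian_objective)

end

theory Submission
  imports Defs
begin

text \<open>Let \<open>x\<^sub>i\<close> be the \<open>i\<close>-th row of \<open>Y\<close> divided by \<open>z\<^sub>i\<close>, a unit vector of a real Euclidean
  space of dimension \<open>d = 2r\<close>, and let \<open>v\<close> be the mean of the \<open>x\<^sub>i\<close> with the diagonal of \<open>D\<close> as
  weights. Testing the Hessian on the tangential parts of \<open>z b\<^sup>T\<close> for \<open>b\<close> in an orthonormal basis, and
  using \<open>S(Y) Y = 0\<close> and \<open>L z = 0\<close>, gives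
  \<open>(d - 1 + |v|\<^sup>2) \<langle>Y, L Y\<rangle> \<le> \<Sum>\<^sub>b \<langle>G\<^sub>b, L G\<^sub>b\<rangle>\<close> with rows
  \<open>(G\<^sub>b)\<^sub>i = \<langle>x\<^sub>i - v, b\<rangle> z\<^sub>i x\<^sub>i\<close>. The weighted spectral bounds for \<open>L\<close> turn this into
  \<open>(d - e) \<lambda>\<^sub>2 e \<le> \<lambda>\<^sub>n (e - e\<^sup>2 / d)\<close> where \<open>e = 1 - |v|\<^sup>2\<close> is the variance of the \<open>x\<^sub>i\<close>, so that
  \<open>\<lambda>\<^sub>n < d \<lambda>\<^sub>2\<close> forces \<open>e = 0\<close>, which means \<open>Y = z v\<^sup>T\<close>.\<close>

section \<open>The spectral theorem for Hermitian matrices\<close>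

lemma linear_quadratic_nonpos:
  fixes a b :: real
  assumes "\<And>t. 2 * t * a + t\<^sup>2 * b \<le> 0"
  shows "a = 0"
proof (rule ccontr)
  assume a: "a \<noteq> 0"
  \<comment> \<open>At this scale the linear term \<open>2 * s * a\<close> becomes
    \<open>s\<^sup>2 * (2 * \<bar>b\<bar> + 2)\<close>, which outweighs \<open>s\<^sup>2 * b\<close>
    whatever the sign of \<open>b\<close>.\<close>
  define s where "s = a / (\<bar>b\<bar> + 1)"
  have s: "s * (\<bar>b\<bar> + 1) = a" by (simp add: s_def)
  have "s \<noteq> 0" using a s by auto
  have "2 * s * a + s\<^sup>2 * b = s\<^sup>2 * (2 * \<bar>b\<bar> + 2 + b)"
    by (subst s[symmetric]) (simp add: algebra_simps power2_eq_square)
  moreover have "s\<^sup>2 * (2 * \<bar>b\<bar> + 2 + b) > 0"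
    using \<open>s \<noteq> 0\<close> by (intro mult_pos_pos) auto
  ultimately show False using assms[of s] by simp
qed

text \<open>The maximizer of the Rayleigh quotient on the unit sphere of \<open>W\<close> is an eigenvector.\<close>

lemma self_adjoint_eigenvector:
  fixes f :: "'a::euclidean_space \<Rightarrow> 'a"
  assumes f: "linear f" and adj: "\<And>x y. inner (f x) y = inner x (f y)"
    and W: "subspace W" and inv: "\<And>x. x \<in> W \<Longrightarrow> f x \<in> W" and ne: "w \<in> W" "w \<noteq> 0"
  obtains e c where "e \<in> W" "norm e = 1" "f e = c *\<^sub>R e"
proof -
  have "compact (W \<inter> sphere 0 1)"
    using closed_subspace[OF W] by (simp add: closed_Int_compact)
  moreover have "(1 / norm w) *\<^sub>R w \<in> W \<inter> sphere 0 1"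
    using ne subspace_scale[OF W] by simp
  moreover have "continuous_on (W \<inter> sphere 0 1) (\<lambda>x. inner x (f x))"
    by (intro continuous_intros linear_continuous_on linear_linear[THEN iffD2] f)
  ultimately obtain e where e: "e \<in> W \<inter> sphere 0 1"
    and max: "\<And>x. x \<in> W \<inter> sphere 0 1 \<Longrightarrow> inner x (f x) \<le> inner e (f e)"
    using continuous_attains_sup[of "W \<inter> sphere 0 1" "\<lambda>x. inner x (f x)"] by blast
  define c where "c = inner e (f e)"
  have le: "inner x (f x) \<le> c * inner x x" if "x \<in> W" for x
  proof (cases "x = 0")
    case False
    define y where "y = (1 / norm x) *\<^sub>R x"
    have y: "y \<in> W \<inter> sphere 0 1" using that False subspace_scale[OF W] by (simp add: y_def)
    have x: "x = norm x *\<^sub>R y" using False by (simp add: y_def)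
    have "inner x (f x) = (norm x)\<^sup>2 * inner y (f y)"
      by (subst (1 2) x) (simp add: linear_cmul[OF f] power2_eq_square)
    also have "\<dots> \<le> (norm x)\<^sup>2 * c"
      using max[OF y] by (simp add: c_def mult_left_mono)
    finally show ?thesis by (simp add: power2_norm_eq_inner mult.commute)
  qed (simp add: linear_0[OF f])
  \<comment> \<open>The residual of \<open>e\<close> serves as direction of variation. It is
    orthogonal to \<open>e\<close>, so comparing the form at \<open>e + t *\<^sub>R g\<close> with
    the bound \<open>le\<close> leaves a quadratic in \<open>t\<close> with linear coefficient
    \<open>2 * inner g g\<close> and no constant term.\<close>
  define g where "g = f e - c *\<^sub>R e"
  have gW: "g \<in> W"
    using e inv subspace_diff[OF W] subspace_scale[OF W] by (simp add: g_def)
  have "2 * t * inner g g + t\<^sup>2 * (inner g (f g) - c * inner g g) \<le> 0" for t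
  proof -
    have fe: "f e = g + c *\<^sub>R e" by (simp add: g_def)
    have ee: "inner e e = 1" using e by (simp add: norm_eq_1)
    have "inner e (f g) = inner (f e) g" by (simp add: adj)
    then have eg: "inner e (f g) = inner g g + c * inner e g"
      by (simp add: fe inner_add_left)
    have ce: "inner e g = 0"
      using ee by (simp add: g_def inner_diff_right c_def)
    have "inner (e + t *\<^sub>R g) (f (e + t *\<^sub>R g)) \<le> c * inner (e + t *\<^sub>R g) (e + t *\<^sub>R g)"
      using e gW subspace_add[OF W] subspace_scale[OF W] by (intro le) auto
    then show ?thesis
      using ee eg ce
      by (simp add: linear_add[OF f] linear_cmul[OF f] inner_add_left inner_add_right fe
          inner_commute[of g e] algebra_simps power2_eq_square)
  qed
  then have "inner g g = 0" by (rule linear_quadratic_nonpos)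
  then have "f e = c *\<^sub>R e" by (simp add: g_def)
  with e that show thesis by auto
qed

section \<open>The Hermitian inner product and orthonormal eigenvectors\<close>

definition cdot :: "complex^'n \<Rightarrow> complex^'n \<Rightarrow> complex" where
  "cdot x y = (\<Sum>i\<in>UNIV. cnj (x $ i) * y $ i)"

lemma cdot_add_right: "cdot x (y + z) = cdot x y + cdot x z"
  and cdot_scale_right: "cdot x (a *s y) = a * cdot x y"
  and cdot_scaleR_right: "cdot x (t *\<^sub>R y) = of_real t * cdot x y"
  and cdot_zero_right [simp]: "cdot x 0 = 0"
  and cdot_scale_left: "cdot (a *s x) y = cnj a * cdot x y"
  and cdot_scaleR_left: "cdot (t *\<^sub>R x) y = of_real t * cdot x y"
  and cdot_zero_left [simp]: "cdot 0 x = 0"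
  by (simp_all add: cdot_def algebra_simps sum.distrib sum_distrib_left
      scaleR_conv_of_real[where 'a = complex])

lemma cdot_sum_right: "cdot x (\<Sum>k\<in>K. f k) = (\<Sum>k\<in>K. cdot x (f k))"
  by (induction K rule: infinite_finite_induct) (simp_all add: cdot_add_right)

lemma cnj_cdot: "cnj (cdot x y) = cdot y x"
  by (simp add: cdot_def mult.commute)

lemma Re_cdot: "Re (cdot x y) = inner x y"
  by (simp add: cdot_def inner_vec_def inner_complex_def)

lemma cdot_self: "cdot x x = of_real ((norm x)\<^sup>2)"
proof -
  have "Im (cdot x x) = 0" by (simp add: cdot_def)
  then show ?thesis
    by (simp add: complex_eq_iff Re_cdot power2_norm_eq_inner del: of_real_power)
qed

lemma Re_cdot_imaginary: "Re (cdot (\<i> *s x) y) = Im (cdot x y)"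
  by (simp add: cdot_scale_left)

lemma quad_form_eq_cdot: "quad_form A x = cdot x (A *v x)"
  by (simp add: quad_form_def cdot_def)

lemma cdot_ctranspose: "cdot (ctranspose A *v x) y = cdot x (A *v y)"
  unfolding cdot_def ctranspose_def matrix_vector_mult_def
  by (simp add: sum_distrib_left sum_distrib_right mult_ac, subst sum.swap, simp)

lemma cdot_hermitian: "hermitian A \<Longrightarrow> cdot (A *v x) y = cdot x (A *v y)"
  using cdot_ctranspose[of A x y] by (simp add: hermitian_def)

text \<open>\<open>inner\<close> is only the real part of \<open>cdot\<close>, so each complex
  condition amounts to two real ones: orthogonality to \<open>u k\<close> and to its multiple by the
  imaginary unit. These are at most \<open>2 * m\<close> conditions in real dimension
  \<open>2 * CARD('n)\<close>.\<close>

lemma exists_nonzero_cdot_orthogonal: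
  fixes u :: "nat \<Rightarrow> complex^'n"
  assumes "m < CARD('n)"
  obtains w where "w \<noteq> 0" "\<And>k. k < m \<Longrightarrow> cdot (u k) w = 0"
proof -
  define S where "S = u ` {..<m} \<union> (\<lambda>k. \<i> *s u k) ` {..<m}"
  have "dim S \<le> card S" by (rule dim_le_card) (auto simp: S_def span_base)
  also have "\<dots> \<le> m + m"
    unfolding S_def
    using card_image_le[of "{..<m}" u] card_image_le[of "{..<m}" "\<lambda>k. \<i> *s u k"]
    by (intro order_trans[OF card_Un_le]) simp
  also have "\<dots> < DIM(complex^'n)" using assms by simp
  finally obtain w where w: "w \<noteq> 0" "\<And>y. y \<in> span S \<Longrightarrow> orthogonal w y"
    using orthogonal_to_subspace_exists by blast
  have "cdot (u k) w = 0" if "k < m" for k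
  proof -
    have "orthogonal w (u k)" "orthogonal w (\<i> *s u k)"
      using that by (auto intro!: w(2) span_base simp: S_def)
    then have "Re (cdot (u k) w) = 0" "Re (cdot (\<i> *s u k) w) = 0"
      by (simp_all only: Re_cdot orthogonal_def inner_commute)
    then show ?thesis by (simp add: Re_cdot_imaginary complex_eq_iff del: cdot_scale_left)
  qed
  then show thesis using w that by blast
qed

text \<open>Induction on \<open>m\<close>: the complement \<open>W\<close> of the vectors found so
  far is invariant under \<open>A\<close>, and \<open>self_adjoint_eigenvector\<close> supplies the
  next one with a real eigenvalue. As \<open>W\<close> is cut out by \<open>cdot\<close> and not by
  \<open>inner\<close>, the new vector is orthogonal in the complex sense.\<close>

lemma hermitian_orthonormal_eigenvectors:
  fixes A :: "complex^'n^'n"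
  assumes A: "hermitian A" and "m \<le> CARD('n)"
  shows "\<exists>u c. (\<forall>j<m. \<forall>k<m. cdot (u j) (u k) = (if j = k then 1 else 0)) \<and>
           (\<forall>k<m. A *v u k = (c k :: real) *\<^sub>R u k)"
  using \<open>m \<le> CARD('n)\<close>
proof (induction m)
  case (Suc m)
  then have "m \<le> CARD('n)" by simp
  from Suc.IH[OF this] obtain u and c :: "nat \<Rightarrow> real" where uc:
    "(\<forall>j<m. \<forall>k<m. cdot (u j) (u k) = (if j = k then 1 else 0)) \<and> (\<forall>k<m. A *v u k = c k *\<^sub>R u k)"
    by (elim exE)
  then have orth: "cdot (u j) (u k) = (if j = k then 1 else 0)" if "j < m" "k < m" for j k
    using that by blast
  have eig: "A *v u k = c k *\<^sub>R u k" if "k < m" for k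
    using that uc by blast
  define W where "W = {x. \<forall>k<m. cdot (u k) x = 0}"
  obtain w where w: "w \<in> W" "w \<noteq> 0"
    using exists_nonzero_cdot_orthogonal[of m u] Suc.prems by (auto simp: W_def)
  have "subspace W"
    by (auto simp: W_def subspace_def cdot_add_right cdot_scaleR_right)
  moreover have "A *v x \<in> W" if "x \<in> W" for x
  proof -
    have "cdot (u k) (A *v x) = 0" if "k < m" for k
    proof -
      have "cdot (u k) (A *v x) = cnj (cdot x (A *v u k))"
        by (simp add: cnj_cdot cdot_hermitian[OF A])
      also have "\<dots> = of_real (c k) * cnj (cdot x (u k))"
        by (simp add: eig[OF \<open>k < m\<close>] cdot_scaleR_right)
      also have "\<dots> = 0" using \<open>x \<in> W\<close> \<open>k < m\<close> by (simp add: cnj_cdot W_def)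
      finally show ?thesis .
    qed
    then show ?thesis by (simp add: W_def)
  qed
  moreover have "inner (A *v x) y = inner x (A *v y)" for x y
    by (metis cdot_hermitian[OF A] Re_cdot)
  moreover have "linear ((*v) A)"
    by (rule linearI)
      (simp_all add: vec_eq_iff matrix_vector_mult_def distrib_left sum.distrib scaleR_sum_right)
  ultimately obtain e a where e: "e \<in> W" "norm e = 1" "A *v e = a *\<^sub>R e"
    using self_adjoint_eigenvector[of "(*v) A" W w] w by blast
  have ue: "cdot (u k) e = 0" "cdot e (u k) = 0" if "k < m" for k
    using e(1) that cnj_cdot[of "u k" e] by (auto simp: W_def)
  have "cdot e e = 1" using e(2) by (simp add: cdot_self)
  with orth ue eig e(3) show ?case
    by (intro exI[of _ "u(m := e)"] exI[of _ "c(m := a)"]) (auto simp: less_Suc_eq)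
qed simp

section \<open>Characteristic polynomials and the ordered eigenvalues\<close>

definition const_mat :: "'a::zero^'n^'m \<Rightarrow> 'a poly^'n^'m" where
  "const_mat A = (\<chi> i j. [:A $ i $ j:])"

lemma const_poly_sum: "[:\<Sum>k\<in>K. f k:] = (\<Sum>k\<in>K. [:f k:])"
proof (induction K rule: infinite_finite_induct)
  case (insert k K)
  then show ?case by (simp flip: insert.IH)
qed simp_all

lemma const_mat_mult: "const_mat (A ** B) = const_mat A ** const_mat B"
  for A :: "'a::comm_ring_1^'n^'m"
  by (simp add: const_mat_def matrix_matrix_mult_def vec_eq_iff const_poly_sum mult.commute)

lemma char_poly_eq_det: "char_poly A = det (mat [:0, 1:] - const_mat A)"
  unfolding char_poly_def const_mat_def mat_def
  by (rule arg_cong[of _ _ det]) (simp add: vec_eq_iff)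

lemma mat_mult_commute: "mat x ** A = A ** mat x"
  for A :: "'a::comm_ring_1^'n^'n"
  by (simp add: matrix_matrix_mult_def mat_def vec_eq_iff if_distrib if_distribR sum.delta
      sum.delta' mult.commute cong: if_cong)

text \<open>The relation \<open>A ** U = U ** B\<close> lifts to polynomial matrices as (X - A) U =
  U (X - B). In the determinants, \<open>det (const_mat U)\<close> divides 1, so it is nonzero and
  cancels.\<close>

lemma char_poly_similar:
  fixes A B U V :: "complex^'n^'n"
  assumes "A ** U = U ** B" and "V ** U = mat 1"
  shows "char_poly A = char_poly B"
proof -
  have "const_mat V ** const_mat U = mat 1"
    unfolding const_mat_mult[symmetric] assms(2)
    by (simp add: const_mat_def mat_def vec_eq_iff one_pCons)
  then have "det (const_mat V) * det (const_mat U) = 1"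
    by (metis det_I det_mul)
  then have nz: "det (const_mat U) \<noteq> 0" by auto
  have d: "X ** M - Y ** M = (X - Y) ** M" "M ** X - M ** Y = M ** (X - Y)"
    for X Y M :: "complex poly^'n^'n"
    by (simp_all add: matrix_matrix_mult_def vec_eq_iff algebra_simps sum_subtractf)
  have "(mat [:0, 1:] - const_mat A) ** const_mat U = const_mat U ** (mat [:0, 1:] - const_mat B)"
    by (simp add: d[symmetric] mat_mult_commute const_mat_mult[symmetric] assms(1))
  then have "char_poly A * det (const_mat U) = det (const_mat U) * char_poly B"
    unfolding char_poly_eq_det by (metis det_mul)
  then show ?thesis using nz by simp
qed

lemma sum_single_eq_image_mset: "(\<Sum>i\<in>K. {#f i#}) = image_mset f (mset_set K)"
  by (induction K rule: infinite_finite_induct) simp_all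

lemma proots_char_poly_diagonal:
  assumes "diagonal A"
  shows "proots (char_poly A) = image_mset (\<lambda>i. A $ i $ i) (mset_set UNIV)"
proof -
  have "char_poly A = (\<Prod>i\<in>UNIV. [:- (A $ i $ i), 1:])"
    unfolding char_poly_def
    by (subst det_diagonal) (use assms in \<open>auto simp: diagonal_def\<close>)
  then show ?thesis
    by (simp add: proots_prod sum_single_eq_image_mset)
qed

text \<open>The vectors are indexed by position in the sorted list of eigenvalues rather than by the
  type \<open>'n\<close>, which carries no order. The shift to \<open>Suc k\<close> is there because
  \<open>eigval\<close> counts from 1.\<close>

definition eigenbasis :: "complex^'n^'n \<Rightarrow> (nat \<Rightarrow> complex^'n) \<Rightarrow> bool" where
  "eigenbasis A u \<longleftrightarrow>
     (\<forall>j<CARD('n). \<forall>k<CARD('n). cdot (u j) (u k) = (if j = k then 1 else 0)) \<and>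
     (\<forall>k<CARD('n). A *v u k = eigval (Suc k) A *\<^sub>R u k)"

text \<open>Orthonormal eigenvectors as columns of \<open>U\<close> conjugate \<open>A\<close> to a
  diagonal matrix, so the roots of \<open>char_poly A\<close> are the numbers \<open>c k\<close>
  with multiplicity.\<close>

lemma hermitian_spectral:
  fixes A :: "complex^'n^'n"
  assumes A: "hermitian A"
  shows hermitian_eigenbasis: "\<exists>u. eigenbasis A u"
    and eigval_mono: "j \<le> k \<Longrightarrow> k < CARD('n) \<Longrightarrow> eigval (Suc j) A \<le> eigval (Suc k) A"
proof -
  let ?n = "CARD('n)"
  from hermitian_orthonormal_eigenvectors[OF A order_refl] obtain u and c :: "nat \<Rightarrow> real" where uc:
    "(\<forall>j<?n. \<forall>k<?n. cdot (u j) (u k) = (if j = k then 1 else 0)) \<and> (\<forall>k<?n. A *v u k = c k *\<^sub>R u k)"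
    by (elim exE)
  then have orth: "cdot (u j) (u k) = (if j = k then 1 else 0)" if "j < ?n" "k < ?n" for j k
    using that by blast
  have eig: "A *v u k = c k *\<^sub>R u k" if "k < ?n" for k
    using that uc by blast
  obtain q :: "'n \<Rightarrow> nat" where q: "bij_betw q UNIV {..<?n}"
    using ex_bij_betw_finite_nat[of "UNIV :: 'n set"] by (auto simp: lessThan_atLeast0)
  have q': "q i < ?n" "q i = q j \<longleftrightarrow> i = j" for i j
    using q by (auto simp: bij_betw_def inj_on_def)
  define U :: "complex^'n^'n" where "U = (\<chi> i j. u (q j) $ i)"
  define B :: "complex^'n^'n" where "B = (\<chi> i j. if i = j then of_real (c (q i)) else 0)"
  have "(ctranspose U ** U) $ i $ j = cdot (u (q i)) (u (q j))" for i j
    by (simp add: U_def ctranspose_def matrix_matrix_mult_def cdot_def)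
  then have 1: "ctranspose U ** U = mat 1"
    by (simp add: vec_eq_iff orth q' mat_def)
  have "(A ** U) $ i $ j = (U ** B) $ i $ j" for i j
  proof -
    have "(A ** U) $ i $ j = (A *v u (q j)) $ i"
      by (simp add: U_def matrix_matrix_mult_def matrix_vector_mult_def)
    also have "\<dots> = (U ** B) $ i $ j"
      by (simp add: eig q' U_def B_def matrix_matrix_mult_def if_distrib
          scaleR_conv_of_real[where 'a = complex]
          mult.commute cong: if_cong)
    finally show ?thesis .
  qed
  then have "A ** U = U ** B" by (simp add: vec_eq_iff)
  then have "char_poly A = char_poly B" using 1 by (rule char_poly_similar)
  moreover have "diagonal B" by (simp add: diagonal_def B_def)
  ultimately have "image_mset Re (proots (char_poly A)) = image_mset (c \<circ> q) (mset_set UNIV)"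
    by (simp add: proots_char_poly_diagonal image_mset.compositionality B_def comp_def)
  also have "\<dots> = image_mset c (mset_set {..<?n})"
    using q by (simp add: image_mset.compositionality[symmetric] image_mset_mset_set bij_betw_def)
  also have "\<dots> = mset (map c [0..<?n])"
    by (simp add: lessThan_atLeast0)
  finally have "eigval_list A = sort (map c [0..<?n])"
    by (simp only: eigval_list_def sorted_list_of_multiset_mset)
  \<comment> \<open>Sorting the indices by eigenvalue, instead of the eigenvalues themselves, yields
    a permutation \<open>p\<close> that also reorders the eigenvectors.\<close>
  also have "\<dots> = map c (sort_key c [0..<?n])"
    by (intro properties_for_sort) simp_all
  finally have list: "eigval_list A = map c (sort_key c [0..<?n])" .
  define p where "p k = sort_key c [0..<?n] ! k" for k
  have p: "p k < ?n" if "k < ?n" for k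
    using nth_mem[of k "sort_key c [0..<?n]"] that by (simp add: p_def)
  have inj: "p j = p k \<longleftrightarrow> j = k" if "j < ?n" "k < ?n" for j k
    unfolding p_def using that by (intro nth_eq_iff_index_eq) simp_all
  have ev: "eigval (Suc k) A = c (p k)" if "k < ?n" for k
    using that by (simp add: eigval_def list p_def)
  have "eigenbasis A (u \<circ> p)"
    by (simp add: eigenbasis_def orth p inj eig ev)
  then show "\<exists>u. eigenbasis A u" by (rule exI[of _ "u \<circ> p"])
  show "eigval (Suc j) A \<le> eigval (Suc k) A" if "j \<le> k" "k < ?n"
    using that sorted_nth_mono[of "eigval_list A" j k] by (simp add: eigval_def list)
qed

text \<open>With the vectors as columns of a square matrix \<open>U\<close>, orthonormality makes
  \<open>ctranspose U\<close> a left inverse of \<open>U\<close>. It is then also a right inverse,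
  which is the expansion.\<close>

lemma orthonormal_expansion:
  fixes u :: "nat \<Rightarrow> complex^'n"
  assumes orth: "\<And>j k. j < CARD('n) \<Longrightarrow> k < CARD('n) \<Longrightarrow> cdot (u j) (u k) = (if j = k then 1 else 0)"
  shows "(\<Sum>k<CARD('n). cdot (u k) x *s u k) = x"
proof -
  obtain q :: "'n \<Rightarrow> nat" where q: "bij_betw q UNIV {..<CARD('n)}"
    using ex_bij_betw_finite_nat[of "UNIV :: 'n set"] by (auto simp: lessThan_atLeast0)
  have q': "q i < CARD('n)" "q i = q j \<longleftrightarrow> i = j" for i j
    using q by (auto simp: bij_betw_def inj_on_def)
  define U :: "complex^'n^'n" where "U = (\<chi> i j. u (q j) $ i)"
  have "(ctranspose U ** U) $ i $ j = cdot (u (q i)) (u (q j))" for i j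
    by (simp add: U_def ctranspose_def matrix_matrix_mult_def cdot_def)
  then have "ctranspose U ** U = mat 1"
    by (simp add: vec_eq_iff orth q' mat_def)
  then have "U ** ctranspose U = mat 1"
    using matrix_left_right_inverse[of "ctranspose U" U] by blast
  then have "x = U *v (ctranspose U *v x)"
    by (simp add: matrix_vector_mul_assoc)
  also have "(ctranspose U *v x) $ j = cdot (u (q j)) x" for j
    by (simp add: matrix_vector_mult_def ctranspose_def U_def cdot_def)
  then have "U *v (ctranspose U *v x) = (\<Sum>j\<in>UNIV. cdot (u (q j)) x *s u (q j))"
    by (subst matrix_vector_mult_def) (simp add: vec_eq_iff U_def mult.commute)
  also have "\<dots> = (\<Sum>k<CARD('n). cdot (u k) x *s u k)"
    by (rule sum.reindex_bij_betw[OF q])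
  finally show ?thesis by simp
qed

section \<open>Quadratic forms in an eigenbasis\<close>

context
  fixes A :: "complex^'n^'n" and u
  assumes u: "eigenbasis A u"
begin

lemma eigenbasis_orthonormal:
  "j < CARD('n) \<Longrightarrow> k < CARD('n) \<Longrightarrow> cdot (u j) (u k) = (if j = k then 1 else 0)"
  using u by (simp add: eigenbasis_def)

lemma eigenbasis_eigenvector: "k < CARD('n) \<Longrightarrow> A *v u k = eigval (Suc k) A *\<^sub>R u k"
  using u by (simp add: eigenbasis_def)

lemma eigenbasis_expansion: "(\<Sum>k<CARD('n). cdot (u k) x *s u k) = x"
  by (rule orthonormal_expansion) (rule eigenbasis_orthonormal)

lemma eigenbasis_parseval: "cdot x y = (\<Sum>k<CARD('n). cnj (cdot (u k) x) * cdot (u k) y)"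
  by (subst (1) eigenbasis_expansion[of y, symmetric])
    (simp add: cdot_sum_right cdot_scale_right cnj_cdot mult.commute)

lemma norm_eigenbasis: "(norm x)\<^sup>2 = (\<Sum>k<CARD('n). (cmod (cdot (u k) x))\<^sup>2)"
proof -
  have "Re (cnj a * a) = (cmod a)\<^sup>2" for a
    unfolding cmod_power2 by (simp add: power2_eq_square)
  moreover have "(norm x)\<^sup>2 = Re (cdot x x)" by (simp add: cdot_self)
  ultimately show ?thesis
    unfolding eigenbasis_parseval[of x] Re_sum by simp
qed

lemma quad_form_eigenbasis:
  assumes A: "hermitian A"
  shows "Re (quad_form A x) = (\<Sum>k<CARD('n). eigval (Suc k) A * (cmod (cdot (u k) x))\<^sup>2)"
proof -
  have "cdot (u k) (A *v x) = of_real (eigval (Suc k) A) * cdot (u k) x" if "k < CARD('n)" for k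
    using cdot_hermitian[OF A, of "u k" x, symmetric] eigenbasis_eigenvector[OF that]
    by (simp add: cdot_scaleR_left)
  moreover have "Re (cnj a * (of_real t * a)) = t * (cmod a)\<^sup>2" for a t
    unfolding cmod_power2 by (simp add: power2_eq_square algebra_simps)
  ultimately show ?thesis
    unfolding quad_form_eq_cdot eigenbasis_parseval[of x] Re_sum by (intro sum.cong refl) simp
qed

end

lemma rayleigh_le_max_eigval:
  fixes A :: "complex^'n^'n"
  assumes A: "hermitian A"
  shows "Re (quad_form A x) \<le> eigval CARD('n) A * (norm x)\<^sup>2"
proof -
  obtain u where u: "eigenbasis A u" using hermitian_eigenbasis[OF A] ..
  have "eigval (Suc k) A \<le> eigval CARD('n) A" if "k < CARD('n)" for k
    using eigval_mono[OF A, of k "CARD('n) - 1"] that by simp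
  then show ?thesis
    unfolding norm_eigenbasis[OF u] quad_form_eigenbasis[OF u A] sum_distrib_left
    by (intro sum_mono mult_right_mono) auto
qed

text \<open>The kernel vector \<open>w\<close> is orthogonal to all \<open>u k\<close> with
  \<open>k \<noteq> 0\<close>, whose eigenvalues are positive. So \<open>w\<close> is a multiple of
  \<open>u 0\<close>, and a vector orthogonal to \<open>w\<close> has no component along
  \<open>u 0\<close>.\<close>

lemma eigval_2_le_rayleigh:
  fixes A :: "complex^'n^'n"
  assumes A: "hermitian A" and n2: "2 \<le> CARD('n)" and pos: "0 < eigval 2 A"
    and w: "A *v w = 0" "w \<noteq> 0" and x: "cdot w x = 0"
  shows "eigval 2 A * (norm x)\<^sup>2 \<le> Re (quad_form A x)"
proof -
  obtain u where u: "eigenbasis A u" using hermitian_eigenbasis[OF A] ..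
  have ge: "eigval 2 A \<le> eigval (Suc k) A" if "k < CARD('n)" "k \<noteq> 0" for k
    using eigval_mono[OF A, of 1 k] that by (simp add: numeral_2_eq_2)
  have "cdot (u k) w = 0" if k: "k < CARD('n)" "k \<noteq> 0" for k
  proof -
    have "of_real (eigval (Suc k) A) * cdot (u k) w = cdot (A *v u k) w"
      by (simp add: eigenbasis_eigenvector[OF u] k cdot_scaleR_left)
    also have "\<dots> = 0" by (simp add: cdot_hermitian[OF A] w)
    finally show ?thesis using ge[OF k] pos by simp
  qed
  then have "(\<Sum>k\<in>{..<CARD('n)} - {0}. cdot (u k) w *s u k) = 0"
    by (intro sum.neutral) simp
  then have "cdot (u 0) w *s u 0 = w"
    using eigenbasis_expansion[OF u, of w] by (subst (asm) sum.remove[of _ 0]) simp_all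
  then have "cdot (u 0) w \<noteq> 0" "cnj (cdot (u 0) w) * cdot (u 0) x = 0"
    using w x cdot_scale_left[of "cdot (u 0) w" "u 0" x] by auto
  then have u0: "cdot (u 0) x = 0" by simp
  show ?thesis
    unfolding norm_eigenbasis[OF u] quad_form_eigenbasis[OF u A] sum_distrib_left
  proof (rule sum_mono)
    fix k assume "k \<in> {..<CARD('n)}"
    then show "eigval 2 A * (cmod (cdot (u k) x))\<^sup>2 \<le> eigval (Suc k) A * (cmod (cdot (u k) x))\<^sup>2"
      using ge[of k] u0 by (cases "k = 0") (simp_all add: mult_right_mono)
  qed
qed

text \<open>Min-max argument: the span of \<open>u 0\<close> and \<open>u 1\<close> contains a
  nonzero \<open>x\<close> orthogonal to \<open>w\<close>. If the second eigenvalue were not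
  positive, the form would be nonpositive at \<open>x\<close>.\<close>

lemma eigval_2_pos:
  fixes A :: "complex^'n^'n"
  assumes A: "hermitian A" and n2: "2 \<le> CARD('n)"
    and pos: "\<And>x. cdot w x = 0 \<Longrightarrow> x \<noteq> 0 \<Longrightarrow> 0 < Re (quad_form A x)"
  shows "0 < eigval 2 A"
proof (rule ccontr)
  assume neg: "\<not> 0 < eigval 2 A"
  obtain u where u: "eigenbasis A u" using hermitian_eigenbasis[OF A] ..
  obtain a b where ab: "a * cdot w (u 0) + b * cdot w (u 1) = 0" "a \<noteq> 0 \<or> b \<noteq> 0"
  proof (cases "cdot w (u 0) = 0")
    case True
    then show thesis using that[of 1 0] by simp
  next
    case False
    then show thesis using that[of "- cdot w (u 1)" "cdot w (u 0)"] by simp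
  qed
  define x where "x = a *s u 0 + b *s u 1"
  have ux: "cdot (u k) x = (if k = 0 then a else if k = 1 then b else 0)" if "k < CARD('n)" for k
    using n2 that by (auto simp: x_def cdot_add_right cdot_scale_right eigenbasis_orthonormal[OF u])
  have "x \<noteq> 0" using ux[of 0] ux[of 1] n2 ab(2) by auto
  moreover have "cdot w x = 0" using ab(1) by (simp add: x_def cdot_add_right cdot_scale_right)
  ultimately have "0 < Re (quad_form A x)" by (rule pos[rotated])
  moreover have "Re (quad_form A x) \<le> 0"
    unfolding quad_form_eigenbasis[OF u A]
  proof (rule sum_nonpos)
    fix k assume k: "k \<in> {..<CARD('n)}"
    have "eigval (Suc k) A \<le> 0" if "k \<le> 1"
      using eigval_mono[OF A, of k 1] that n2 neg by (simp add: numeral_2_eq_2)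
    with k show "eigval (Suc k) A * (cmod (cdot (u k) x))\<^sup>2 \<le> 0"
      by (auto simp: ux mult_nonpos_nonneg)
  qed
  ultimately show False by simp
qed

section \<open>Rescaling by the diagonal matrix\<close>

lemma pos_def_diagonal_entry: "pos_def D \<Longrightarrow> 0 < Re (D $ i $ i)"
proof -
  assume "pos_def D"
  moreover have "quad_form D (axis i 1) = D $ i $ i"
    by (simp add: quad_form_def matrix_vector_mult_def axis_def if_distrib if_distribR cong: if_cong)
  moreover have "axis i (1 :: complex) \<noteq> 0" by (simp add: axis_eq_0_iff)
  ultimately show ?thesis by (auto simp: pos_def_def dest!: spec[of _ "axis i 1"])
qed

lemma diag_inv_sqrt_mult_vec:
  "(diag_inv_sqrt D *v x) $ i = of_real (1 / sqrt (Re (D $ i $ i))) * x $ i"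
  by (simp add: diag_inv_sqrt_def matrix_vector_mult_def if_distrib if_distribR cong: if_cong)

lemma hermitian_diag_inv_sqrt: "hermitian (diag_inv_sqrt D)"
  by (simp add: hermitian_def ctranspose_def diag_inv_sqrt_def vec_eq_iff)

lemma quad_form_congruence:
  assumes "hermitian T"
  shows "quad_form (T ** L ** T) x = quad_form L (T *v x)"
  by (simp add: quad_form_eq_cdot cdot_hermitian[OF assms] flip: matrix_vector_mul_assoc)

lemma hermitian_congruence:
  assumes "hermitian T" "hermitian L"
  shows "hermitian (T ** L ** T)"
  using assms by (simp add: hermitian_def ctranspose_mult matrix_mul_assoc)

lemma eigval_2_scaled_pos:
  fixes L D :: "complex^'n^'n"
  assumes L: "hermitian L" "2 \<le> CARD('n)" "0 < eigval 2 L" "L *v z = 0" "z \<noteq> 0"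
    and D: "pos_def D"
  shows "0 < eigval 2 (diag_inv_sqrt D ** L ** diag_inv_sqrt D)"
\<comment> \<open>The comparison vector is D^(-1/2) z, not the kernel vector D^(1/2) z of the scaled
  matrix. With this choice, orthogonality of \<open>x\<close> says that the rescaled
  \<open>x\<close> is orthogonal to \<open>z\<close>.\<close>
proof (rule eigval_2_pos[where w = "diag_inv_sqrt D *v z"])
  fix x assume "cdot (diag_inv_sqrt D *v z) x = 0" "x \<noteq> 0"
  then have "cdot z (diag_inv_sqrt D *v x) = 0"
    by (simp add: cdot_hermitian[OF hermitian_diag_inv_sqrt])
  from eigval_2_le_rayleigh[OF L(1-5) this]
  have le: "eigval 2 L * (norm (diag_inv_sqrt D *v x))\<^sup>2
      \<le> Re (quad_form (diag_inv_sqrt D ** L ** diag_inv_sqrt D) x)"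
    by (simp add: quad_form_congruence[OF hermitian_diag_inv_sqrt])
  obtain i where "x $ i \<noteq> 0" using \<open>x \<noteq> 0\<close> by (auto simp: vec_eq_iff)
  then have "(diag_inv_sqrt D *v x) $ i \<noteq> 0"
    using pos_def_diagonal_entry[OF D, of i] by (simp add: diag_inv_sqrt_mult_vec)
  then have "diag_inv_sqrt D *v x \<noteq> 0" by auto
  with L(3) le show "0 < Re (quad_form (diag_inv_sqrt D ** L ** diag_inv_sqrt D) x)"
    by (meson less_le_trans mult_pos_pos zero_less_norm_iff zero_less_power)
qed (use L hermitian_congruence hermitian_diag_inv_sqrt in auto)

text \<open>Change of variables by D^(1/2), called \<open>r\<close>: the form of \<open>L\<close> at
  \<open>x\<close> is that of \<open>L'\<close> at \<open>r x\<close>, the weighted square sum is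
  the squared norm of \<open>r x\<close>, and the hypothesis on \<open>x\<close> says that
  \<open>r x\<close> is orthogonal to the kernel vector \<open>r z\<close> of
  \<open>L'\<close>.\<close>

lemma scaled_rayleigh_bounds:
  fixes L D :: "complex^'n^'n"
  defines "L' \<equiv> diag_inv_sqrt D ** L ** diag_inv_sqrt D"
  assumes L: "hermitian L" "2 \<le> CARD('n)" "0 < eigval 2 L'" "L *v z = 0" "z \<noteq> 0"
    and D: "pos_def D"
    and x: "(\<Sum>i\<in>UNIV. Re (D $ i $ i) *\<^sub>R (cnj (z $ i) * x $ i)) = 0"
  shows "eigval 2 L' * (\<Sum>i\<in>UNIV. Re (D $ i $ i) * (cmod (x $ i))\<^sup>2) \<le> Re (quad_form L x)"
    and "Re (quad_form L x) \<le> eigval CARD('n) L' * (\<Sum>i\<in>UNIV. Re (D $ i $ i) * (cmod (x $ i))\<^sup>2)"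
proof -
  note d = pos_def_diagonal_entry[OF D]
  define r where "r y = (\<chi> i. of_real (sqrt (Re (D $ i $ i))) * y $ i)" for y :: "complex^'n"
  have inv: "diag_inv_sqrt D *v r y = y" for y
    using d by (simp add: vec_eq_iff diag_inv_sqrt_mult_vec r_def less_imp_neq[symmetric])
  have L': "hermitian L'"
    unfolding L'_def by (intro hermitian_congruence hermitian_diag_inv_sqrt L)
  have q: "quad_form L' (r x) = quad_form L x"
    by (simp add: L'_def quad_form_congruence[OF hermitian_diag_inv_sqrt] inv)
  have n: "(norm (r x))\<^sup>2 = (\<Sum>i\<in>UNIV. Re (D $ i $ i) * (cmod (x $ i))\<^sup>2)"
    using d by (simp add: norm_vec_def L2_set_def r_def sum_nonneg norm_mult power_mult_distrib
        less_imp_le)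
  have "L' *v r z = 0"
    by (simp add: L'_def inv L flip: matrix_vector_mul_assoc)
  moreover have "r z \<noteq> 0" using inv[of z] L(5) by auto
  moreover have "cdot (r z) (r x) = 0"
  proof -
    have "of_real (sqrt t) * cnj a * (of_real (sqrt t) * b) = t *\<^sub>R (cnj a * b)" if "0 < t"
      for a b :: complex and t
    proof -
      have "of_real (sqrt t) * of_real (sqrt t) = complex_of_real t"
        using that by (simp flip: of_real_mult)
      then show ?thesis by (simp add: scaleR_conv_of_real mult_ac)
    qed
    then show ?thesis using x d by (simp add: cdot_def r_def)
  qed
  ultimately show "eigval 2 L' * (\<Sum>i\<in>UNIV. Re (D $ i $ i) * (cmod (x $ i))\<^sup>2) \<le> Re (quad_form L x)"
    using eigval_2_le_rayleigh[OF L' L(2,3)] q n by metis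
  show "Re (quad_form L x) \<le> eigval CARD('n) L' * (\<Sum>i\<in>UNIV. Re (D $ i $ i) * (cmod (x $ i))\<^sup>2)"
    using rayleigh_le_max_eigval[OF L', of "r x"] q n by metis
qed

lemma inner_mult_eq_sum_quad_form:
  "inner U (L ** U) = (\<Sum>k\<in>UNIV. Re (quad_form L (column k U)))"
  for U :: "complex^'r^'n"
proof -
  have "inner U (L ** U) = (\<Sum>i\<in>UNIV. \<Sum>k\<in>UNIV. inner (U $ i $ k) ((L ** U) $ i $ k))"
    by (simp add: inner_vec_def)
  also have "\<dots> = (\<Sum>k\<in>UNIV. \<Sum>i\<in>UNIV. inner (U $ i $ k) ((L ** U) $ i $ k))"
    by (rule sum.swap)
  also have "\<dots> = (\<Sum>k\<in>UNIV. Re (quad_form L (column k U)))"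
    by (simp add: quad_form_def column_def matrix_matrix_mult_def matrix_vector_mult_def
        inner_complex_def)
  finally show ?thesis .
qed

lemma scaled_matrix_bounds:
  fixes L D :: "complex^'n^'n" and U :: "complex^'r^'n"
  defines "L' \<equiv> diag_inv_sqrt D ** L ** diag_inv_sqrt D"
  assumes L: "hermitian L" "2 \<le> CARD('n)" "0 < eigval 2 L'" "L *v z = 0" "z \<noteq> 0"
    and D: "pos_def D"
    and U: "(\<Sum>i\<in>UNIV. Re (D $ i $ i) *\<^sub>R (cnj (z $ i) *s U $ i)) = 0"
  shows "eigval 2 L' * (\<Sum>i\<in>UNIV. Re (D $ i $ i) * (norm (U $ i))\<^sup>2) \<le> inner U (L ** U)"
    and "inner U (L ** U) \<le> eigval CARD('n) L' * (\<Sum>i\<in>UNIV. Re (D $ i $ i) * (norm (U $ i))\<^sup>2)"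
proof -
  have "(\<Sum>i\<in>UNIV. Re (D $ i $ i) * (norm (U $ i))\<^sup>2) =
      (\<Sum>i\<in>UNIV. \<Sum>k\<in>UNIV. Re (D $ i $ i) * (cmod (U $ i $ k))\<^sup>2)"
    by (simp add: norm_vec_def L2_set_def sum_nonneg sum_distrib_left)
  also have "\<dots> = (\<Sum>k\<in>UNIV. \<Sum>i\<in>UNIV. Re (D $ i $ i) * (cmod (column k U $ i))\<^sup>2)"
    by (subst sum.swap) (simp add: column_def)
  finally have n: "(\<Sum>i\<in>UNIV. Re (D $ i $ i) * (norm (U $ i))\<^sup>2) =
      (\<Sum>k\<in>UNIV. \<Sum>i\<in>UNIV. Re (D $ i $ i) * (cmod (column k U $ i))\<^sup>2)" .
  have "(\<Sum>i\<in>UNIV. Re (D $ i $ i) *\<^sub>R (cnj (z $ i) * column k U $ i)) = 0" for k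
    using arg_cong[OF U, of "\<lambda>v. v $ k"] by (simp add: column_def)
  note bounds = scaled_rayleigh_bounds[OF L(1,2) L(3)[unfolded L'_def] L(4,5) D this, folded L'_def]
  show "eigval 2 L' * (\<Sum>i\<in>UNIV. Re (D $ i $ i) * (norm (U $ i))\<^sup>2) \<le> inner U (L ** U)"
    unfolding n inner_mult_eq_sum_quad_form sum_distrib_left[of _ _ UNIV]
    using bounds(1) by (intro sum_mono) (simp add: sum_distrib_left)
  show "inner U (L ** U) \<le> eigval CARD('n) L' * (\<Sum>i\<in>UNIV. Re (D $ i $ i) * (norm (U $ i))\<^sup>2)"
    unfolding n inner_mult_eq_sum_quad_form sum_distrib_left[of _ _ UNIV]
    using bounds(2) by (intro sum_mono) (simp add: sum_distrib_left)
qed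

section \<open>Second-order critical points have rank one\<close>

lemma norm_vector_scalar_mult: "norm (a *s x) = cmod a * norm x"
  for x :: "complex^'r"
  by (simp add: norm_vec_def norm_mult L2_set_right_distrib)

lemma inner_unit_scale: "cmod a = 1 \<Longrightarrow> inner (a *s x) (a *s y) = inner x y"
  for x y :: "complex^'r"
  by (metis (no_types, lifting) Re_cdot cdot_scale_left cdot_scale_right complex_cnj_mult
      complex_norm_square mult.assoc mult.commute mult_1 of_real_1 power_one)

lemma sum_Basis_inner_mult: "(\<Sum>b\<in>Basis. inner x b * inner y b) = inner x y"
  for x y :: "'a::euclidean_space"
  by (simp add: euclidean_inner[of x y])

text \<open>Each vector splits orthogonally into \<open>b - inner y b *\<^sub>R y\<close> and
  \<open>inner v b *\<^sub>R y\<close>. The first parts contribute the dimension of the unit sphere,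
  the second ones the squared norm of \<open>v\<close>.\<close>

lemma sum_Basis_norm_residual:
  fixes y v :: "'a::euclidean_space"
  assumes "norm y = 1"
  shows "(\<Sum>b\<in>Basis. (norm (b - inner (y - v) b *\<^sub>R y))\<^sup>2) = real DIM('a) - 1 + (norm v)\<^sup>2"
proof -
  have yy: "inner y y = 1" using assms by (simp add: norm_eq_1)
  have "(norm (b - inner (y - v) b *\<^sub>R y))\<^sup>2 =
      1 - 2 * (inner (y - v) b * inner y b) + inner (y - v) b * inner (y - v) b"
    if "b \<in> Basis" for b
  proof -
    have "(norm (b - c *\<^sub>R y))\<^sup>2 = 1 - 2 * (c * inner y b) + c * c" for c
      using that by (simp add: power2_norm_eq_inner inner_diff_left inner_diff_right yy inner_commute[of b y]
          algebra_simps)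
    then show ?thesis .
  qed
  then have "(\<Sum>b\<in>Basis. (norm (b - inner (y - v) b *\<^sub>R y))\<^sup>2) =
      DIM('a) - 2 * inner (y - v) y + inner (y - v) (y - v)"
    by (simp add: sum.distrib sum_subtractf sum_Basis_inner_mult flip: sum_distrib_left)
  also have "\<dots> = real DIM('a) - 1 + (norm v)\<^sup>2"
    by (simp add: power2_norm_eq_inner inner_diff_left inner_diff_right yy inner_commute)
  finally show ?thesis .
qed

text \<open>By the assumption on \<open>v\<close>, the vectors \<open>g b\<close> are the columns of
  \<open>R = \<Sum>\<^sub>i d\<^sub>i (x\<^sub>i - v)(x\<^sub>i - v)\<^sup>T\<close>, so this is \<open>(tr R)\<^sup>2 \<le> dim * |R|\<^sup>2\<close>.\<close>

lemma trace_squared_le: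
  fixes x :: "'i \<Rightarrow> 'a::euclidean_space" and d :: "'i \<Rightarrow> real"
  assumes v: "(\<Sum>i\<in>I. d i *\<^sub>R (x i - v)) = 0"
  defines "g \<equiv> \<lambda>b. \<Sum>i\<in>I. (d i * inner (x i - v) b) *\<^sub>R x i"
  shows "(\<Sum>i\<in>I. d i * (norm (x i - v))\<^sup>2)\<^sup>2 \<le> DIM('a) * (\<Sum>b\<in>Basis. (norm (g b))\<^sup>2)"
proof -
  have "(\<Sum>b\<in>Basis. inner (g b) b) = (\<Sum>i\<in>I. \<Sum>b\<in>Basis. d i * (inner (x i - v) b * inner (x i) b))"
    unfolding g_def inner_sum_left by (subst sum.swap) (simp add: mult.assoc)
  also have "\<dots> = (\<Sum>i\<in>I. d i * inner (x i - v) (x i))"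
    by (simp add: sum_Basis_inner_mult flip: sum_distrib_left)
  \<comment> \<open>Replacing \<open>x i\<close> by \<open>x i - v\<close> in the second factor
    costs a term that vanishes by the assumption on \<open>v\<close>.\<close>
  also have "\<dots> = (\<Sum>i\<in>I. d i * (norm (x i - v))\<^sup>2) + inner (\<Sum>i\<in>I. d i *\<^sub>R (x i - v)) v"
    unfolding inner_sum_left sum.distrib[symmetric]
    by (intro sum.cong refl)
      (simp add: power2_norm_eq_inner inner_diff_left inner_diff_right inner_commute algebra_simps)
  finally have "(\<Sum>i\<in>I. d i * (norm (x i - v))\<^sup>2)\<^sup>2 = (\<Sum>b\<in>Basis. inner (g b) b)\<^sup>2"
    by (simp add: v)
  also have "\<dots> \<le> (\<Sum>b\<in>Basis. (inner (g b) b)\<^sup>2) * DIM('a)"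
    by (rule sum_squared_le_sum_of_squares)
  also have "\<dots> \<le> (\<Sum>b\<in>Basis. (norm (g b))\<^sup>2) * DIM('a)"
    by (intro mult_right_mono sum_mono abs_le_square_iff[THEN iffD1])
      (auto intro: Basis_le_norm)
  finally show ?thesis by (simp add: mult.commute)
qed

section \<open>Matrices z b^T and the Hessian inequality\<close>

definition rank_one :: "complex^'n \<Rightarrow> complex^'r \<Rightarrow> complex^'r^'n" where
  "rank_one z b = (\<chi> i. z $ i *s b)"

lemma mult_rank_one: "L *v z = 0 \<Longrightarrow> L ** rank_one z b = 0"
  by (simp add: vec_eq_iff rank_one_def matrix_matrix_mult_def matrix_vector_mult_def
      flip: mult.assoc sum_distrib_right)

lemma mult_diff_right: "A ** (U - V) = A ** U - A ** V"
  and mult_scaleR_right: "A ** (t *\<^sub>R U) = t *\<^sub>R (A ** U)"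
  for A :: "complex^'n^'m" and U V :: "complex^'r^'n"
proof -
  have "linear (\<lambda>U :: complex^'r^'n. A ** U)" by (rule linear_mult_left)
  then show "A ** (U - V) = A ** U - A ** V"
    "A ** (t *\<^sub>R U) = t *\<^sub>R (A ** U)"
    by (rule linear_diff linear_cmul)+
qed

text \<open>The columns of \<open>rank_one z b\<close> are multiples of \<open>z\<close>, so the
  form ignores them. This permits subtracting a weighted mean before the spectral bounds are
  applied.\<close>

lemma inner_mult_shift:
  assumes "hermitian L" "L *v z = 0"
  shows "inner (rank_one z b - U) (L ** (rank_one z b - U)) = inner U (L ** U)"
proof -
  have "inner (rank_one z b) (L ** U) = 0"
    using inner_mult_hermitian[OF assms(1), of "rank_one z b" U] assms(2) by (simp add: mult_rank_one)
  then show ?thesis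
    by (simp add: mult_diff_right mult_rank_one assms(2) inner_diff_left)
qed

context
  fixes C L :: "complex^'n^'n" and z :: "complex^'n" and Y :: "complex^'r^'n"
  assumes C: "hermitian C" and z: "\<And>i. cmod (z $ i) = 1"
    and L_def: "L = certificate C (outer z)" and Lz: "L *v z = 0"
begin

lemma hermitian_L: "hermitian L"
  unfolding L_def by (rule hermitian_certificate[OF C])

lemma L_mult_row: "(L ** V) $ i = Re ((C ** outer z) $ i $ i) *\<^sub>R V $ i - (C ** V) $ i"
  for V :: "complex^'k^'n"
  by (simp add: L_def certificate_def matrix_mult_diff_left re_ddiag_mult_row)

text \<open>On unit rows the diagonal part of \<open>L\<close> contributes a constant, so maximizing
  the objective amounts to minimizing the form of \<open>L\<close>.\<close>

lemma objective_feasible: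
  assumes "feasible (V :: complex^'k^'n)"
  shows "objective C V = (\<Sum>i\<in>UNIV. Re ((C ** outer z) $ i $ i)) - inner V (L ** V)"
proof -
  have "inner V (L ** V) = (\<Sum>i\<in>UNIV. Re ((C ** outer z) $ i $ i) - inner (V $ i) ((C ** V) $ i))"
    unfolding inner_rows[of V] using assms
    by (intro sum.cong refl) (simp add: L_mult_row inner_diff_right feasible_iff norm_eq_1)
  also have "\<dots> = (\<Sum>i\<in>UNIV. Re ((C ** outer z) $ i $ i)) - inner V (C ** V)"
    by (simp add: sum_subtractf inner_rows[of V])
  finally show ?thesis
    by (simp add: objective_def mat_inner_mult_ctranspose[OF C])
qed

text \<open>S(Y) and \<open>L\<close> are both a real diagonal matrix minus \<open>C\<close>; on
  unit rows their diagonals differ by \<open>inner ((L ** Y) $ i) (Y $ i)\<close>.\<close>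

lemma certificate_row:
  fixes V :: "complex^'k^'n"
  assumes "feasible Y"
  shows "(certificate C (Y ** ctranspose Y) ** V) $ i = (L ** V) $ i - inner ((L ** Y) $ i) (Y $ i) *\<^sub>R V $ i"
  using assms
  by (simp add: certificate_mult_row L_mult_row inner_diff_left feasible_iff norm_eq_1 scaleR_diff_left)

text \<open>The test directions are the tangential parts of \<open>z b\<^sup>T\<close> for \<open>b\<close> in a real orthonormal basis.
  They equal \<open>z b\<^sup>T - G b\<close> up to a multiple of \<open>Y\<close>, which \<open>S(Y)\<close> annihilates,
  and \<open>L\<close> annihilates \<open>z b\<^sup>T\<close>.\<close>

lemma hessian_inequality:
  fixes v :: "complex^'r"
  assumes Y: "second_order_critical (objective C) Y"
  defines "x \<equiv> \<lambda>i. cnj (z $ i) *s Y $ i"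
  defines "G \<equiv> \<lambda>b. \<chi> i. z $ i *s (inner (x i - v) b *\<^sub>R x i)"
  shows "(2 * real CARD('r) - 1 + (norm v)\<^sup>2) * inner Y (L ** Y) \<le> (\<Sum>b\<in>Basis. inner (G b) (L ** G b))"
proof -
  define S where "S = certificate C (Y ** ctranspose Y)"
  define m where "m i = inner ((L ** Y) $ i) (Y $ i)" for i
  have feas: "feasible Y" and SY: "S ** Y = 0"
    and hess: "\<And>V. V \<in> tangent_space Y \<Longrightarrow> 0 \<le> mat_inner S (V ** ctranspose V)"
    using Y by (simp_all add: second_order_critical_objective_iff[OF C] S_def)
  have S: "hermitian S" unfolding S_def by (rule hermitian_certificate[OF C])
  have Srow: "(S ** V) $ i = (L ** V) $ i - m i *\<^sub>R V $ i" for V :: "complex^'r^'n" and i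
    by (simp add: S_def m_def certificate_row[OF feas])
  have Yx: "Y $ i = z $ i *s x i" for i
    using z[of i] complex_norm_square[of "z $ i"] by (simp add: x_def vec_eq_iff flip: mult.assoc)
  have nx: "norm (x i) = 1" for i
    using feas z by (simp add: x_def norm_vector_scalar_mult feasible_iff)
  have step: "(\<Sum>i\<in>UNIV. m i * (norm (b - inner (x i - v) b *\<^sub>R x i))\<^sup>2) \<le> inner (G b) (L ** G b)" for b
  proof -
    define W where "W = rank_one z b - G b"
    have nW: "norm (W $ i) = norm (b - inner (x i - v) b *\<^sub>R x i)" for i
    proof -
      have "W $ i = z $ i *s (b - inner (x i - v) b *\<^sub>R x i)"
        by (simp add: W_def rank_one_def G_def vec_eq_iff algebra_simps)
      then show ?thesis by (simp only: norm_vector_scalar_mult z mult_1)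
    qed
    define V where "V = W - inner v b *\<^sub>R Y"
    \<comment> \<open>The vector \<open>v\<close> drops out here: what remains is the part of
      \<open>b\<close> orthogonal to \<open>x i\<close>, rotated by \<open>z $ i\<close>, hence
      tangential.\<close>
    have Vrow: "V $ i = z $ i *s (b - inner (x i) b *\<^sub>R x i)" for i
      by (simp add: V_def W_def rank_one_def G_def Yx inner_diff_left vec_eq_iff algebra_simps)
    have "inner (Y $ i) (V $ i) = 0" for i
      using nx[of i] z
      by (simp add: Vrow Yx[of i] inner_unit_scale inner_diff_right norm_eq_1)
    then have "0 \<le> mat_inner S (V ** ctranspose V)"
      by (intro hess) (simp add: tangent_space_iff)
    also have "\<dots> = inner V (S ** V)" by (rule mat_inner_mult_ctranspose[OF S])
    also have "S ** V = S ** W" by (simp add: V_def mult_diff_right mult_scaleR_right SY)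
    also have "inner V (S ** W) = inner W (S ** W)"
      using inner_mult_hermitian[OF S, of Y W] by (simp add: V_def inner_diff_left SY)
    also have "\<dots> = inner W (L ** W) - (\<Sum>i\<in>UNIV. m i * (norm (W $ i))\<^sup>2)"
      by (simp add: inner_rows[of W] Srow inner_diff_right sum_subtractf power2_norm_eq_inner)
    also have "inner W (L ** W) = inner (G b) (L ** G b)"
      unfolding W_def by (rule inner_mult_shift[OF hermitian_L Lz])
    finally show ?thesis by (simp add: nW)
  qed
  \<comment> \<open>The weights \<open>m i\<close> add up to \<open>inner Y (L ** Y)\<close>, and
    the real dimension of \<open>complex^'r\<close> is the source of the factor 2r.\<close>
  have "(2 * real CARD('r) - 1 + (norm v)\<^sup>2) * inner Y (L ** Y) =
      (\<Sum>i\<in>UNIV. m i * (real DIM(complex^'r) - 1 + (norm v)\<^sup>2))"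
    by (simp add: m_def inner_rows[of Y] inner_commute mult.commute flip: sum_distrib_right)
  also have "\<dots> = (\<Sum>i\<in>UNIV. m i * (\<Sum>b\<in>Basis. (norm (b - inner (x i - v) b *\<^sub>R x i))\<^sup>2))"
    by (simp only: sum_Basis_norm_residual[OF nx])
  also have "\<dots> = (\<Sum>b\<in>Basis. \<Sum>i\<in>UNIV. m i * (norm (b - inner (x i - v) b *\<^sub>R x i))\<^sup>2)"
    unfolding sum_distrib_left by (rule sum.swap)
  also have "\<dots> \<le> (\<Sum>b\<in>Basis. inner (G b) (L ** G b))"
    by (intro sum_mono step)
  finally show ?thesis .
qed

end

section \<open>Variance of the rotated rows\<close>

lemma weighted_mean:
  fixes w :: "'i \<Rightarrow> 'a::real_inner" and d :: "'i \<Rightarrow> real"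
  assumes m: "(\<Sum>i\<in>I. d i) *\<^sub>R m = (\<Sum>i\<in>I. d i *\<^sub>R w i)"
  shows "(\<Sum>i\<in>I. d i *\<^sub>R (w i - m)) = 0"
    and "(\<Sum>i\<in>I. d i * (norm (w i - m))\<^sup>2) =
      (\<Sum>i\<in>I. d i * (norm (w i))\<^sup>2) - (\<Sum>i\<in>I. d i) * (norm m)\<^sup>2"
proof -
  show "(\<Sum>i\<in>I. d i *\<^sub>R (w i - m)) = 0"
    using m by (simp add: scaleR_diff_right sum_subtractf flip: scaleR_sum_left)
  have "d i * (norm (w i - m))\<^sup>2 = d i * (norm (w i))\<^sup>2 - 2 * inner (d i *\<^sub>R w i) m + d i * (norm m)\<^sup>2" for i
    by (simp add: power2_norm_eq_inner inner_diff_left inner_diff_right inner_commute algebra_simps)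
  then have "(\<Sum>i\<in>I. d i * (norm (w i - m))\<^sup>2) =
      (\<Sum>i\<in>I. d i * (norm (w i))\<^sup>2) - 2 * inner (\<Sum>i\<in>I. d i *\<^sub>R w i) m + (\<Sum>i\<in>I. d i) * (norm m)\<^sup>2"
    by (simp add: sum.distrib sum_subtractf inner_sum_left sum_distrib_right flip: sum_distrib_left)
  also have "\<dots> = (\<Sum>i\<in>I. d i * (norm (w i))\<^sup>2) - (\<Sum>i\<in>I. d i) * (norm m)\<^sup>2"
    by (simp add: m[symmetric] power2_norm_eq_inner)
  finally show "(\<Sum>i\<in>I. d i * (norm (w i - m))\<^sup>2) =
      (\<Sum>i\<in>I. d i * (norm (w i))\<^sup>2) - (\<Sum>i\<in>I. d i) * (norm m)\<^sup>2" .
qed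

text \<open>Multiplying \<open>main\<close> by \<open>d\<close> and inserting
  \<open>e\<^sup>2 \<le> d * s\<close> leaves \<open>t * e * (d - e)\<close> times
  \<open>d * l\<close> on the left and times \<open>l'\<close> on the right. For nonzero
  \<open>e\<close> this common factor is positive, as \<open>e \<le> 1 < d\<close>, and cancelling
  it contradicts \<open>l' < d * l\<close>.\<close>

lemma deviation_zero:
  fixes d e t s l l' :: real
  assumes "0 < t" "2 \<le> d" "0 \<le> e" "e \<le> 1" "0 < l'" "l' < d * l" "e\<^sup>2 \<le> d * s"
    and main: "(d - e) * (l * (t * e)) \<le> l' * (t * e - t * s)"
  shows "e = 0"
proof (rule ccontr)
  assume "e \<noteq> 0"
  then have e: "0 < t * e * (d - e)" using assms by simp
  have "t * (d * s) \<ge> t * e\<^sup>2" using assms by (intro mult_left_mono) auto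
  then have "d * (t * e - t * s) \<le> t * e * (d - e)"
    by (simp add: algebra_simps power2_eq_square)
  then have "l' * (d * (t * e - t * s)) \<le> l' * (t * e * (d - e))"
    using assms by (intro mult_left_mono) auto
  moreover have "d * ((d - e) * (l * (t * e))) \<le> d * (l' * (t * e - t * s))"
    using main assms by (intro mult_left_mono) auto
  ultimately have "(d * l) * (t * e * (d - e)) \<le> l' * (t * e * (d - e))"
    by (simp add: mult_ac)
  moreover have "l' * (t * e * (d - e)) < (d * l) * (t * e * (d - e))"
    using assms(6) e by (rule mult_strict_right_mono)
  ultimately show False by simp
qed

theorem second_order_critical_rank_one:
  fixes C D :: "complex^'n^'n" and z :: "complex^'n" and Y :: "complex^'r^'n"
  defines "L \<equiv> certificate C (outer z)"
  defines "L' \<equiv> diag_inv_sqrt D ** L ** diag_inv_sqrt D"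
  assumes n: "CARD('n) \<ge> 2" and C: "hermitian C" and z: "\<And>i. cmod (z $ i) = 1"
    and Lz: "L *v z = 0" and D: "pos_def D"
    and pos: "0 < eigval 2 L'" and cond: "eigval CARD('n) L' < 2 * real CARD('r) * eigval 2 L'"
    and Y: "second_order_critical (objective C) Y"
  obtains v where "norm v = 1" "Y = rank_one z v"
proof -
  define d where "d i = Re (D $ i $ i)" for i
  define t where "t = (\<Sum>i\<in>UNIV. d i)"
  define x where "x i = cnj (z $ i) *s Y $ i" for i
  define v where "v = (1 / t) *\<^sub>R (\<Sum>i\<in>UNIV. d i *\<^sub>R x i)"
  define c where "c b i = inner (x i - v) b" for b i
  define G :: "complex^'r \<Rightarrow> complex^'r^'n" where "G b = (\<chi> i. z $ i *s (c b i *\<^sub>R x i))" for b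
  \<comment> \<open>The mean of the rotated rows of \<open>G b\<close>: the shift by
    \<open>rank_one z (g b)\<close> makes the weighted spectral bounds applicable to
    \<open>G b\<close>.\<close>
  define g where "g b = (1 / t) *\<^sub>R (\<Sum>i\<in>UNIV. d i *\<^sub>R (c b i *\<^sub>R x i))" for b
  have d: "0 < d i" for i using pos_def_diagonal_entry[OF D] by (simp add: d_def)
  then have t: "0 < t" by (simp add: t_def sum_pos)
  have z0: "z \<noteq> 0" using z by (metis norm_zero zero_index zero_neq_one)
  have L: "hermitian L" unfolding L_def by (rule hermitian_certificate[OF C])
  have zz: "cnj (z $ i) * (z $ i) = 1" for i
    using z[of i] complex_norm_square[of "z $ i"] by (simp add: mult.commute)
  have Yx: "Y $ i = z $ i *s x i" for i
    using zz[of i] by (simp add: x_def vec_eq_iff mult.commute flip: mult.assoc)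
  have feas: "feasible Y" using Y by (simp add: second_order_critical_def)
  then have nx: "norm (x i) = 1" for i
    using z by (simp add: x_def norm_vector_scalar_mult feasible_iff)
  note bounds = scaled_matrix_bounds[OF L n pos[unfolded L'_def] Lz z0 D, folded L'_def d_def]
  note mean = weighted_mean[where I = UNIV and d = d, folded t_def]
  have tv: "t *\<^sub>R v = (\<Sum>i\<in>UNIV. d i *\<^sub>R x i)"
    and tg: "t *\<^sub>R g b = (\<Sum>i\<in>UNIV. d i *\<^sub>R (c b i *\<^sub>R x i))" for b
    using t by (simp_all add: v_def g_def)
  define e where "e = 1 - (norm v)\<^sup>2"
  have var_x: "(\<Sum>i\<in>UNIV. d i * (norm (x i - v))\<^sup>2) = t * e"
    using mean(2)[OF tv] by (simp add: nx e_def right_diff_distrib flip: t_def)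
  have dev_x: "(\<Sum>i\<in>UNIV. d i *\<^sub>R (x i - v)) = 0"
    using mean(1)[OF tv] .
  \<comment> \<open>Undoing the rotation by \<open>z\<close> turns the orthogonality hypothesis of
    the spectral bounds into the statement that the weighted deviations of the \<open>w i\<close>
    from \<open>a\<close> sum to zero.\<close>
  have shifted_row: "cnj (z $ i) *s (rank_one z a - U) $ i = - (w i - a)"
      "norm ((rank_one z a - U) $ i) = norm (w i - a)"
    if "\<And>i. U $ i = z $ i *s w i" for U :: "complex^'r^'n" and w a i
  proof -
    have row: "(rank_one z a - U) $ i = z $ i *s (a - w i)"
      by (simp add: rank_one_def that vec_eq_iff algebra_simps)
    show "cnj (z $ i) *s (rank_one z a - U) $ i = - (w i - a)"
      unfolding row by (simp add: zz vec_eq_iff flip: mult.assoc)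
    show "norm ((rank_one z a - U) $ i) = norm (w i - a)"
      unfolding row by (simp only: norm_vector_scalar_mult z mult_1 norm_minus_commute)
  qed
  have lower: "eigval 2 L' * (t * e) \<le> inner Y (L ** Y)"
  proof -
    have "(\<Sum>i\<in>UNIV. d i *\<^sub>R (cnj (z $ i) *s (rank_one z v - Y) $ i)) = 0"
      using dev_x by (simp only: shifted_row(1)[OF Yx] scaleR_minus_right sum_negf) simp
    from bounds(1)[OF this] show ?thesis
      by (simp only: shifted_row(2)[OF Yx] var_x inner_mult_shift[OF L Lz])
  qed
  have upper: "inner (G b) (L ** G b) \<le>
      eigval CARD('n) L' * ((\<Sum>i\<in>UNIV. d i * (c b i)\<^sup>2) - t * (norm (g b))\<^sup>2)" for b
  proof -
    have row: "G b $ i = z $ i *s (c b i *\<^sub>R x i)" for i by (simp add: G_def)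
    have var: "(\<Sum>i\<in>UNIV. d i * (norm (c b i *\<^sub>R x i - g b))\<^sup>2) =
        (\<Sum>i\<in>UNIV. d i * (c b i)\<^sup>2) - t * (norm (g b))\<^sup>2"
      using mean(2)[OF tg] by (simp add: nx)
    have dev: "(\<Sum>i\<in>UNIV. d i *\<^sub>R (c b i *\<^sub>R x i - g b)) = 0"
      using mean(1)[OF tg] .
    have "(\<Sum>i\<in>UNIV. d i *\<^sub>R (cnj (z $ i) *s (rank_one z (g b) - G b) $ i)) = 0"
      using dev by (simp only: shifted_row(1)[OF row] scaleR_minus_right sum_negf) simp
    from bounds(2)[OF this] show ?thesis
      by (simp only: shifted_row(2)[OF row] var inner_mult_shift[OF L Lz])
  qed
  have sum_c: "(\<Sum>b\<in>Basis. \<Sum>i\<in>UNIV. d i * (c b i)\<^sup>2) = t * e"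
    unfolding var_x[symmetric]
    by (subst sum.swap) (simp add: c_def power2_eq_square sum_Basis_inner_mult dot_square_norm
        flip: sum_distrib_left)
  define s where "s = (\<Sum>b\<in>Basis. (norm (g b))\<^sup>2)"
  have r: "1 \<le> real CARD('r)" by (simp add: Suc_le_eq)
  have r_e: "2 * real CARD('r) - 1 + (norm v)\<^sup>2 = 2 * real CARD('r) - e" by (simp add: e_def)
  have "(2 * real CARD('r) - 1 + (norm v)\<^sup>2) * (eigval 2 L' * (t * e)) \<le>
      (2 * real CARD('r) - 1 + (norm v)\<^sup>2) * inner Y (L ** Y)"
    by (intro mult_left_mono lower add_nonneg_nonneg zero_le_power2) (use r in linarith)
  also have "\<dots> \<le> (\<Sum>b\<in>Basis. inner (G b) (L ** G b))"
    using hessian_inequality[OF C z _ Lz Y, of v] by (simp add: L_def G_def c_def x_def)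
  also have "\<dots> \<le> eigval CARD('n) L' * (t * e - t * s)"
    unfolding s_def sum_c[symmetric]
    by (rule order_trans[OF sum_mono[OF upper]])
      (simp add: sum_distrib_left sum_subtractf flip: sum_distrib_left[of "eigval _ _"])
  finally have main: "(2 * real CARD('r) - e) * (eigval 2 L' * (t * e)) \<le>
      eigval CARD('n) L' * (t * e - t * s)"
    by (simp only: r_e)
  \<comment> \<open>The columns in \<open>trace_squared_le\<close> are here
    \<open>t *\<^sub>R g b\<close>, so that \<open>t\<^sup>2\<close> appears on both sides and can
    be cancelled.\<close>
  have "(t * e)\<^sup>2 \<le> t\<^sup>2 * (2 * real CARD('r) * s)"
  proof -
    have "(\<Sum>i\<in>UNIV. (d i * c b i) *\<^sub>R x i) = t *\<^sub>R g b" for b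
      by (simp add: tg)
    then show ?thesis
      using trace_squared_le[OF dev_x]
      by (simp add: var_x s_def power_mult_distrib mult_ac flip: c_def sum_distrib_left)
  qed
  then have "e\<^sup>2 \<le> 2 * real CARD('r) * s" using t by (simp add: power_mult_distrib)
  moreover have "0 \<le> t * e" unfolding var_x[symmetric] using d by (intro sum_nonneg) (simp add: less_imp_le)
  \<comment> \<open>This makes the largest eigenvalue positive, as \<open>deviation_zero\<close>
    requires.\<close>
  moreover have "eigval 2 L' \<le> eigval CARD('n) L'"
    using eigval_mono[of L' 1 "CARD('n) - 1"] n hermitian_congruence[OF hermitian_diag_inv_sqrt L]
    by (simp add: L'_def numeral_2_eq_2)
  moreover have "e \<le> 1" by (simp add: e_def)
  ultimately have e: "e = 0"
    using t pos cond main r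
    by (intro deviation_zero[of t "2 * real CARD('r)" e "eigval CARD('n) L'" "eigval 2 L'" s])
      (auto simp: zero_le_mult_iff)
  then have "norm v = 1"
    using norm_ge_zero[of v] by (auto simp: e_def power2_eq_1_iff simp del: norm_ge_zero)
  \<comment> \<open>Zero variance with positive weights forces every rotated row to equal the
    mean.\<close>
  moreover have "d i * (norm (x i - v))\<^sup>2 = 0" for i
    using var_x d by (simp add: e sum_nonneg_eq_0_iff less_imp_le)
  then have "x i = v" for i using less_imp_neq[OF d[of i]] by (metis mult_eq_0_iff
      power_eq_0_iff norm_eq_zero right_minus_eq)
  then have "Y = rank_one z v" using Yx by (simp add: vec_eq_iff rank_one_def)
  ultimately show thesis by (rule that)
qed

section \<open>Global optimality\<close>

lemma rank_one_mult_ctranspose: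
  assumes "norm v = 1"
  shows "rank_one z v ** ctranspose (rank_one z v) = outer z"
proof -
  have v: "(\<Sum>k\<in>UNIV. v $ k * cnj (v $ k)) = 1"
    using cdot_self[of v] assms by (simp add: cdot_def mult.commute)
  have "(rank_one z v ** ctranspose (rank_one z v)) $ i $ j =
      z $ i * cnj (z $ j) * (\<Sum>k\<in>UNIV. v $ k * cnj (v $ k))" for i j
    by (simp add: rank_one_def ctranspose_def matrix_matrix_mult_def sum_distrib_left mult_ac)
  then show ?thesis by (simp add: v outer_def vec_eq_iff)
qed

lemma inner_psd_mult_nonneg: "pos_semidef L \<Longrightarrow> 0 \<le> inner V (L ** V)"
  by (simp add: inner_mult_eq_sum_quad_form pos_semidef_def sum_nonneg)

theorem theorem2p2:
  fixes C D :: "complex^'n^'n" and z :: "complex^'n"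
  defines "L \<equiv> certificate C (outer z)"
  defines "L\<^sub>D \<equiv> diag_inv_sqrt D ** L ** diag_inv_sqrt D"
  assumes "CARD('n) \<ge> 2"
    and "hermitian C"
    and "\<forall>i. norm (z $ i) = 1"
    and "L *v z = 0"
    and "pos_semidef L"
    and "eigval 2 L > 0"
    and "diagonal D" and "pos_def D"
    and "2 * real CARD('r) > eigval CARD('n) L\<^sub>D / eigval 2 L\<^sub>D"
  shows "\<forall>Y::complex^'r^'n. second_order_critical (objective C) Y \<longrightarrow>
           global_optimum C Y \<and> Y ** ctranspose Y = outer z"
proof (intro allI impI)
  fix Y :: "complex^'r^'n" assume Y: "second_order_critical (objective C) Y"
  note n = assms(3) and C = assms(4) and z = assms(5)[rule_format] and Lz = assms(6)
    and psd = assms(7) and D = assms(10)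
  have z0: "z \<noteq> 0" using z by (metis norm_zero zero_index zero_neq_one)
  have L: "hermitian L" using psd by (simp add: pos_semidef_def)
  \<comment> \<open>The quotient in the hypothesis can be cleared only once its denominator is known
    to be positive.\<close>
  have pos: "0 < eigval 2 L\<^sub>D"
    unfolding L\<^sub>D_def by (rule eigval_2_scaled_pos[OF L n assms(8) Lz z0 D])
  then have "eigval CARD('n) L\<^sub>D < 2 * real CARD('r) * eigval 2 L\<^sub>D"
    using assms(11) by (simp add: pos_divide_less_eq)
  then obtain v where v: "norm v = 1" "Y = rank_one z v"
    using second_order_critical_rank_one[OF n C z Lz[unfolded L_def] D pos[unfolded L\<^sub>D_def L_def] _ Y]
    unfolding L\<^sub>D_def L_def by blast
  have feas: "feasible Y" using Y by (simp add: second_order_critical_def)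
  \<comment> \<open>The form of \<open>L\<close> thus vanishes at \<open>Y\<close>, while
    semidefiniteness keeps it nonnegative at any other feasible point.\<close>
  have "L ** Y = 0" unfolding v(2) by (rule mult_rank_one[OF Lz])
  then have "objective C Y' \<le> objective C Y" if "feasible Y'" for Y' :: "complex^'r^'n"
    using that feas inner_psd_mult_nonneg[OF psd, of Y']
    by (simp add: objective_feasible[OF C z L_def[THEN meta_eq_to_obj_eq] Lz])
  then show "global_optimum C Y \<and> Y ** ctranspose Y = outer z"
    using feas rank_one_mult_ctranspose[OF v(1), of z] v(2) by (simp add: global_optimum_def)
qed

end
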